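(* Synchronizability is undecidable: there is no algorithm that, given a message set $M$ and an $M$-system $S$, decides whether $S$ is synchronizable. Likewise, language synchronizability is undecidable.
   Context: A message set $M=(\Sigma_M,n,\mathrm{src},\mathrm{dst})$ consists of a finite set $\Sigma_M$ of messages, a number $n\ge 1$ of peers, and maps $\mathrm{src},\mathrm{dst}:\Sigma_M\to\{1,\dots,n\}$ with $\mathrm{src}(a)\neq\mathrm{dst}(a)$. Actions are $!a$ (send, by peer $\mathrm{src}(a)$) and $?a$ (receive, by peer $\mathrm{dst}(a)$). An $M$-trace is a finite sequence of actions; $!?a$ abbreviates $!a\cdot ?a$. For a trace $\tau$, $\pi_!(\tau)$ is the sequence of messages sent in $\tau$; for channel $i\to j$, $\mathrm{buf}_{i\to j}(\tau)$ is the word $w$ (if it exists) such that (messages sent on $i\to j$) $=$ (messages received on $i\to j$)$\cdot w$. $\tau$ is FIFO (resp. $k$-bounded FIFO) if for all $i,j$ and prefixes $\tau'$, $\mathrm{buf}_{i\to j}(\tau')$ is defined (resp. defined and of length $\le k$); synchronous if $\tau=!?a_1\cdots!?a_k$. An $M$-system $S=(P_1,\dots,P_n)$ consists of finite automata $P_i$ (all states accepting) over the actions of peer $i$, communicating through one FIFO channel per ordered pair $(i,j)$, $i\ne j$ (peer-to-peer communication). A configuration gives a control state per peer and the content $w_{i,j}$ of each channel; it is stable if all channels are empty. $!a$ with $\mathrm{src}(a)=i,\mathrm{dst}(a)=j$ moves $P_i$ and appends $a$ to $w_{i,j}$; $?a$ moves $P_j$ and removes $a$ from the head of $w_{i,j}$.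 $c_0$ is the initial configuration (initial states, empty channels). $T_k(S)$ ($k\ge1$) is the set of $k$-bounded FIFO traces $\tau$ with $c_0\xrightarrow{\tau}c$ for some $c$; $T_0(S)$ the synchronous such traces; $T_\omega(S)=\bigcup_k T_k(S)$. $ST^w_k(S)=\{\pi_!(\tau)\mid\tau\in T_k(S)\}$ and $ST_k(S)=ST^w_k(S)\cup\{(\pi_!(\tau),c)\mid c_0\xrightarrow{\tau}c,\ c\text{ stable},\ \tau\in T_k(S)\}$. $S$ is synchronizable if $ST_0(S)=ST_\omega(S)$ and language synchronizable if $ST^w_0(S)=ST^w_\omega(S)$. *)

theory Defs
  imports Main "HOL-Library.Nat_Bijection"
begin

datatype recf = Zero | Succ | Proj nat | Comp recf "recf list" | Prim recf recf | Mu recf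

inductive eval :: "recf \<Rightarrow> nat list \<Rightarrow> nat \<Rightarrow> bool" where
  eval_Zero: "eval Zero xs 0"
| eval_Succ: "eval Succ (x # xs) (Suc x)"
| eval_Proj: "i < length xs \<Longrightarrow> eval (Proj i) xs (xs ! i)"
| eval_Comp: "length ys = length gs \<Longrightarrow> (\<forall>i < length gs. eval (gs ! i) xs (ys ! i))
              \<Longrightarrow> eval f ys z \<Longrightarrow> eval (Comp f gs) xs z"
| eval_Prim0: "eval f xs z \<Longrightarrow> eval (Prim f g) (0 # xs) z"
| eval_PrimS: "eval (Prim f g) (n # xs) y \<Longrightarrow> eval g (n # y # xs) z
              \<Longrightarrow> eval (Prim f g) (Suc n # xs) z"
| eval_Mu: "eval f (n # xs) 0 \<Longrightarrow> (\<forall>m < n. \<exists>y. eval f (m # xs) (Suc y))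
              \<Longrightarrow> eval (Mu f) xs n"

definition decidable_on :: "('a \<Rightarrow> bool) \<Rightarrow> ('a \<Rightarrow> nat) \<Rightarrow> ('a \<Rightarrow> bool) \<Rightarrow> bool" where
  "decidable_on valid enc P \<longleftrightarrow>
     (\<exists>f. \<forall>x. valid x \<longrightarrow> eval f [enc x] (if P x then 1 else 0))"

text \<open>Action: (True, a) is the send !a, (False, a) is the receive ?a. Messages are nat ids.\<close>
type_synonym action = "bool \<times> nat"
text \<open>Peer automaton: initial state and finite transition list (all states accepting).\<close>
type_synonym peer_aut = "nat \<times> (nat \<times> action \<times> nat) list"
text \<open>Message set: number of peers n and list of messages (a, src a, dst a).\<close>
type_synonym msgset = "nat \<times> (nat \<times> nat \<times> nat) list"
text \<open>System: message set M and automata P_1..P_n (list index i-1 is peer i).\<close>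
type_synonym system = "msgset \<times> peer_aut list"

definition npeers :: "system \<Rightarrow> nat" where "npeers S = fst (fst S)"
definition msgs :: "system \<Rightarrow> (nat \<times> nat \<times> nat) list" where "msgs S = snd (fst S)"
definition peers :: "system \<Rightarrow> peer_aut list" where "peers S = snd S"
definition Sigma :: "system \<Rightarrow> nat set" where "Sigma S = fst ` set (msgs S)"
definition src :: "system \<Rightarrow> nat \<Rightarrow> nat" where "src S a = fst (the (map_of (msgs S) a))"
definition dst :: "system \<Rightarrow> nat \<Rightarrow> nat" where "dst S a = snd (the (map_of (msgs S) a))"

definition wf_system :: "system \<Rightarrow> bool" where
  "wf_system S \<longleftrightarrow>
     npeers S \<ge> 1 \<and> distinct (map fst (msgs S)) \<and>
     (\<forall>(a, s, d) \<in> set (msgs S). s \<in> {1..npeers S} \<and> d \<in> {1..npeers S} \<and> s \<noteq> d) \<and>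
     length (peers S) = npeers S \<and>
     (\<forall>i < npeers S. \<forall>(p, (b, a), q) \<in> set (snd (peers S ! i)).
        a \<in> Sigma S \<and> (if b then src S a = Suc i else dst S a = Suc i))"

text \<open>Configuration: control state per peer (index i-1 for peer i), channel contents w_{i,j}.\<close>
type_synonym config = "nat list \<times> (nat \<times> nat \<Rightarrow> nat list)"

definition init_config :: "system \<Rightarrow> config" where
  "init_config S = (map fst (peers S), \<lambda>_. [])"

definition stable :: "config \<Rightarrow> bool" where
  "stable c \<longleftrightarrow> (\<forall>i j. snd c (i, j) = [])"

definition trans_of :: "system \<Rightarrow> nat \<Rightarrow> (nat \<times> action \<times> nat) set" where
  "trans_of S i = set (snd (peers S ! (i - 1)))"

inductive step :: "system \<Rightarrow> config \<Rightarrow> action \<Rightarrow> config \<Rightarrow> bool" where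
  step_send: "i = src S a \<Longrightarrow> j = dst S a \<Longrightarrow> (st ! (i - 1), (True, a), q) \<in> trans_of S i
    \<Longrightarrow> step S (st, ch) (True, a) (st[i - 1 := q], ch((i, j) := ch (i, j) @ [a]))"
| step_recv: "i = src S a \<Longrightarrow> j = dst S a \<Longrightarrow> ch (i, j) = a # w
    \<Longrightarrow> (st ! (j - 1), (False, a), q) \<in> trans_of S j
    \<Longrightarrow> step S (st, ch) (False, a) (st[j - 1 := q], ch((i, j) := w))"

inductive run :: "system \<Rightarrow> config \<Rightarrow> action list \<Rightarrow> config \<Rightarrow> bool" where
  run_Nil: "run S c [] c"
| run_Cons: "step S c x c' \<Longrightarrow> run S c' t c'' \<Longrightarrow> run S c (x # t) c''"

definition sent_on :: "system \<Rightarrow> nat \<Rightarrow> nat \<Rightarrow> action list \<Rightarrow> nat list" where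
  "sent_on S i j t = map snd (filter (\<lambda>(b, a). b \<and> src S a = i \<and> dst S a = j) t)"

definition recv_on :: "system \<Rightarrow> nat \<Rightarrow> nat \<Rightarrow> action list \<Rightarrow> nat list" where
  "recv_on S i j t = map snd (filter (\<lambda>(b, a). \<not> b \<and> src S a = i \<and> dst S a = j) t)"

definition k_bounded_fifo :: "system \<Rightarrow> nat \<Rightarrow> action list \<Rightarrow> bool" where
  "k_bounded_fifo S k t \<longleftrightarrow>
     (\<forall>m \<le> length t. \<forall>i j. \<exists>w. sent_on S i j (take m t) = recv_on S i j (take m t) @ w
                                  \<and> length w \<le> k)"

definition synchronous :: "action list \<Rightarrow> bool" where
  "synchronous t \<longleftrightarrow> (\<exists>as. t = concat (map (\<lambda>a. [(True, a), (False, a)]) as))"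

definition traces :: "system \<Rightarrow> nat \<Rightarrow> action list set" where
  "traces S k = {t. (if k = 0 then synchronous t else k_bounded_fifo S k t)
                     \<and> (\<exists>c. run S (init_config S) t c)}"

definition traces_omega :: "system \<Rightarrow> action list set" where
  "traces_omega S = (\<Union>k \<in> {1..}. traces S k)"

definition sends :: "action list \<Rightarrow> nat list" where
  "sends t = map snd (filter fst t)"

datatype obs = Word "nat list" | WordConf "nat list" config

definition ST_of :: "system \<Rightarrow> action list set \<Rightarrow> obs set" where
  "ST_of S Ts = (\<lambda>t. Word (sends t)) ` Ts \<union>
     {WordConf (sends t) c | t c. t \<in> Ts \<and> run S (init_config S) t c \<and> stable c}"

definition synchronizable :: "system \<Rightarrow> bool" where
  "synchronizable S \<longleftrightarrow> ST_of S (traces S 0) = ST_of S (traces_omega S)"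

definition language_synchronizable :: "system \<Rightarrow> bool" where
  "language_synchronizable S \<longleftrightarrow> sends ` traces S 0 = sends ` traces_omega S"

definition enc_action :: "action \<Rightarrow> nat" where
  "enc_action x = prod_encode (if fst x then 1 else 0, snd x)"
definition enc_trans :: "nat \<times> action \<times> nat \<Rightarrow> nat" where
  "enc_trans x = prod_encode (fst x, prod_encode (enc_action (fst (snd x)), snd (snd x)))"
definition enc_aut :: "peer_aut \<Rightarrow> nat" where
  "enc_aut P = prod_encode (fst P, list_encode (map enc_trans (snd P)))"
definition enc_msg :: "nat \<times> nat \<times> nat \<Rightarrow> nat" where
  "enc_msg m = prod_encode (fst m, prod_encode (snd m))"
definition enc_system :: "system \<Rightarrow> nat" where
  "enc_system S = prod_encode (npeers S,
     prod_encode (list_encode (map enc_msg (msgs S)), list_encode (map enc_aut (peers S))))"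

end

(* The checker peer of a system receives the letters of a word w twice, once directly from one peer and
   once through a relay. If it ignores the garbage message that another peer sends it first, it can run
   as an automaton with two one-way heads on w, and the text between the heads is a queue, so such
   automata simulate arbitrary computations. If it reads the garbage, it ends in a sink that receives
   everything and sends nothing. In a synchronous run the garbage is received at once, so the checker
   never signals acceptance. An asynchronous run may leave the garbage in its channel, so the checker can
   signal acceptance as soon as the simulated computation halts. If it does not halt, each asynchronous
   run has a synchronous counterpart with the same sends and the same final configuration, if that is
   stable. Given a decision procedure, some machine halts on its own code exactly if the system that
   runs it on this code is synchronizable, that is, exactly if it does not halt. *)

theory Submission
  imports Defs
begin

section \<open>Two-head automata\<close>

text \<open>The two-head automaton cannot write. A letter is enqueued by reading it with the leading
  head, because the trailing head has to meet the same letter later. The word is thus a guess of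
  everything that will ever be enqueued, and acceptance asks for some word; a diverging computation
  accepts none. Two obstacles shape the ring. The garbage needs a sender of its own: on a channel
  shared with letters, FIFO order would force the checker to read it first. And a synchronous run
  must reproduce the order of all sends of an asynchronous one. Hence a single token travels through
  the peers 2, 3, 4: each of their sends causally follows the previous one, only receptions can lag,
  and the sink takes letters at any time. Self-reference comes from the encoding. The number
  \<open>e\<close> enters the system only as the start state of the checker and the length of a
  chain of transitions, so the code of the system is an explicit recursive function of
  \<open>e\<close> as soon as \<open>e\<close> also codes the other transitions of the
  checker.\<close>

type_synonym letter = "bool \<times> bool"
type_synonym streams = "bool list \<times> bool list"
type_synonym ltrans = "nat \<times> letter \<times> nat"

fun reads :: "letter \<Rightarrow> streams \<Rightarrow> streams \<Rightarrow> bool" where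
  "reads (h, x) (a, b) (a', b') \<longleftrightarrow> (if h then a = x # a' \<and> b' = b else b = x # b' \<and> a' = a)"

definition hstep :: "ltrans set \<Rightarrow> ((nat \<times> streams) \<times> (nat \<times> streams)) set" where
  "hstep T = {((p, c), (q, c')). \<exists>l. (p, l, q) \<in> T \<and> reads l c c'}"

text \<open>The number of steps is recorded because it is the measure for the induction over loop
  iterations.\<close>

definition acc :: "ltrans set \<Rightarrow> nat \<Rightarrow> nat \<Rightarrow> streams \<Rightarrow> bool" where
  "acc T n p c \<longleftrightarrow> (\<exists>c'. ((p, c), (1, c')) \<in> hstep T ^^ n)"

lemma acc_0 [simp]: "acc T 0 p c \<longleftrightarrow> p = 1"
  by (auto simp: acc_def)

lemma acc_Suc: "acc T (Suc n) p c \<longleftrightarrow> (\<exists>l q c'. (p, l, q) \<in> T \<and> reads l c c' \<and> acc T n q c')"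
proof
  assume "acc T (Suc n) p c"
  then obtain c' y where "((p, c), y) \<in> hstep T" "(y, (1, c')) \<in> hstep T ^^ n"
    unfolding acc_def by (meson relpow_Suc_D2)
  then show "\<exists>l q c'. (p, l, q) \<in> T \<and> reads l c c' \<and> acc T n q c'"
    unfolding acc_def by (cases y) (simp add: hstep_def del: split_paired_Ex, blast)
next
  assume "\<exists>l q c'. (p, l, q) \<in> T \<and> reads l c c' \<and> acc T n q c'"
  then obtain l q c' c'' where "(p, l, q) \<in> T" "reads l c c'" "((q, c'), (1, c'')) \<in> hstep T ^^ n"
    unfolding acc_def by blast
  then have "((p, c), (1, c'')) \<in> hstep T ^^ Suc n"
    by (intro relpow_Suc_I2[of _ "(q, c')"]) (auto simp: hstep_def simp del: split_paired_Ex)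
  then show "acc T (Suc n) p c"
    unfolding acc_def by blast
qed

text \<open>Stands in for a silent branch from \<open>p\<close> to \<open>p1\<close> or
  \<open>p2\<close>. State 1 is excluded because it accepts in zero steps, whatever its transitions
  are.\<close>

lemma acc_Un:
  assumes "\<And>l x. (p, l, x) \<in> T \<longleftrightarrow> (p1, l, x) \<in> T \<or> (p2, l, x) \<in> T" "p \<noteq> 1" "p1 \<noteq> 1" "p2 \<noteq> 1"
  shows "acc T n p c \<longleftrightarrow> acc T n p1 c \<or> acc T n p2 c"
  using assms by (cases n) (simp_all add: acc_Suc del: split_paired_Ex split_paired_All, blast)

text \<open>Pool of internal automaton states. The remaining states have a fixed role later on: 1 accepts,
  3 is the sink, and the even states feed the input into the queue.\<close>

definition work_states :: "nat set" where
  "work_states = {p. odd p \<and> 5 \<le> p}"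

lemma fresh_work_state:
  assumes "finite F"
  obtains p where "p \<in> work_states" "p \<notin> F"
proof -
  have "\<exists>p. p \<in> work_states \<and> p \<ge> n" for n
    by (intro exI[of _ "2 * n + 5"]) (auto simp: work_states_def)
  then have "infinite work_states"
    by (meson finite_nat_set_iff_bounded linorder_not_less)
  then have "infinite (work_states - F)"
    using assms by simp
  then show thesis
    using that by (metis DiffD1 DiffD2 finite.emptyI ex_in_conv)
qed

text \<open>Only the transitions that leave a state of \<open>V\<close> are fixed; elsewhere
  \<open>T'\<close> is arbitrary and may lead into \<open>V\<close>.\<close>

definition agree :: "nat set \<Rightarrow> ltrans set \<Rightarrow> ltrans set \<Rightarrow> bool" where
  "agree V T T' \<longleftrightarrow> (\<forall>v\<in>V. \<forall>l x. (v, l, x) \<in> T' \<longleftrightarrow> (v, l, x) \<in> T)"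

text \<open>Soundness and completeness of a program fragment with entry \<open>p\<close> and exit
  \<open>q\<close>, expressed by acceptance from the exit instead of arrival at the exit. The strict
  decrease \<open>m < n\<close> makes loops well-founded.\<close>

definition simulates :: "ltrans set \<Rightarrow> nat \<Rightarrow> nat \<Rightarrow> streams rel \<Rightarrow> bool" where
  "simulates T p q D \<longleftrightarrow>
     (\<forall>n c. acc T n p c \<longrightarrow> (\<exists>c' m. (c, c') \<in> D \<and> m < n \<and> acc T m q c')) \<and>
     (\<forall>n c c'. (c, c') \<in> D \<longrightarrow> acc T n q c' \<longrightarrow> (\<exists>m. acc T m p c))"

text \<open>Continuation style: the exit \<^term>\<open>q\<close> is arbitrary, and the automaton may be embedded in any
  larger one that does not touch its states \<^term>\<open>V\<close>. This makes composition and loops possible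
  without silent transitions.\<close>

definition definable :: "streams rel \<Rightarrow> bool" where
  "definable D \<longleftrightarrow> (\<forall>F q. finite F \<longrightarrow> (\<exists>T V p. finite T \<and> finite V \<and> V \<inter> F = {} \<and>
     V \<subseteq> work_states \<and> p \<in> V \<and> fst ` T \<subseteq> V \<and> (snd \<circ> snd) ` T \<subseteq> insert q V \<and>
     (\<forall>T'. agree V T T' \<longrightarrow> simulates T' p q D)))"

lemma definableE:
  assumes "definable D" "finite F"
  obtains T V p where "finite T" "finite V" "V \<inter> F = {}" "V \<subseteq> work_states" "p \<in> V" "fst ` T \<subseteq> V"
    "(snd \<circ> snd) ` T \<subseteq> insert q V" "\<And>T'. agree V T T' \<Longrightarrow> simulates T' p q D"
  using assms unfolding definable_def by metis

lemma not_one_work: "p \<in> work_states \<Longrightarrow> p \<noteq> 1"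
  by (auto simp: work_states_def)

lemma definable_letter: "definable {(c, c'). reads l c c'}"
  unfolding definable_def
proof (intro allI impI)
  fix F :: "nat set" and q
  assume "finite F"
  then obtain p where p: "p \<in> work_states" "p \<notin> F"
    by (rule fresh_work_state)
  have "simulates T' p q {(c, c'). reads l c c'}" if "agree {p} {(p, l, q)} T'" for T'
    unfolding simulates_def
  proof (intro conjI allI impI)
    fix n c assume "acc T' n p c"
    with that not_one_work[OF p(1)] show "\<exists>c' m. (c, c') \<in> {(c, c'). reads l c c'} \<and> m < n \<and> acc T' m q c'"
      by (cases n) (auto simp: acc_Suc agree_def)
  next
    fix n c c' assume "(c, c') \<in> {(c, c'). reads l c c'}" "acc T' n q c'"
    then have "acc T' (Suc n) p c"
      using that unfolding acc_Suc agree_def by blast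
    then show "\<exists>m. acc T' m p c" ..
  qed
  then show "\<exists>T V p. finite T \<and> finite V \<and> V \<inter> F = {} \<and> V \<subseteq> work_states \<and> p \<in> V \<and>
     fst ` T \<subseteq> V \<and> (snd \<circ> snd) ` T \<subseteq> insert q V \<and>
     (\<forall>T'. agree V T T' \<longrightarrow> simulates T' p q {(c, c'). reads l c c'})"
    using p by (intro exI[of _ "{(p, l, q)}"] exI[of _ "{p}"] exI[of _ p]) auto
qed

lemma definable_empty: "definable {}"
  unfolding definable_def
proof (intro allI impI)
  fix F :: "nat set" and q
  assume "finite F"
  then obtain p where p: "p \<in> work_states" "p \<notin> F"
    by (rule fresh_work_state)
  have "simulates T' p q {}" if "agree {p} {} T'" for T'
    unfolding simulates_def
  proof (intro conjI allI impI)
    fix n c assume "acc T' n p c"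
    with that not_one_work[OF p(1)] show "\<exists>c' m. (c, c') \<in> {} \<and> m < n \<and> acc T' m q c'"
      by (cases n) (auto simp: acc_Suc agree_def)
  qed auto
  then show "\<exists>T V p. finite T \<and> finite V \<and> V \<inter> F = {} \<and> V \<subseteq> work_states \<and> p \<in> V \<and>
     fst ` T \<subseteq> V \<and> (snd \<circ> snd) ` T \<subseteq> insert q V \<and>
     (\<forall>T'. agree V T T' \<longrightarrow> simulates T' p q {})"
    using p by (intro exI[of _ "{}"] exI[of _ "{p}"] exI[of _ p]) auto
qed

lemma simulates_comp:
  assumes "simulates T p r D" "simulates T r q E"
  shows "simulates T p q (D O E)"
  unfolding simulates_def
proof (intro conjI allI impI)
  fix n c assume "acc T n p c"
  then obtain c' m where 1: "(c, c') \<in> D" "m < n" "acc T m r c'"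
    using assms(1) unfolding simulates_def by blast
  then obtain c'' k where "(c', c'') \<in> E" "k < m" "acc T k q c''"
    using assms(2) unfolding simulates_def by blast
  with 1 show "\<exists>c' m. (c, c') \<in> D O E \<and> m < n \<and> acc T m q c'"
    by (meson less_trans relcompI)
next
  fix n c c'' assume "(c, c'') \<in> D O E" "acc T n q c''"
  then show "\<exists>m. acc T m p c"
    using assms unfolding simulates_def by blast
qed

lemma agree_Un:
  assumes "agree (V1 \<union> V2) (T1 \<union> T2) T'" "V1 \<inter> V2 = {}" "fst ` T1 \<subseteq> V1" "fst ` T2 \<subseteq> V2"
  shows "agree V1 T1 T'" "agree V2 T2 T'"
  using assms unfolding agree_def by (fastforce simp: image_subset_iff)+

lemma definable_comp:
  assumes "definable D" "definable E"
  shows "definable (D O E)"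
  unfolding definable_def
proof (intro allI impI)
  fix F :: "nat set" and q
  assume "finite F"
  \<comment> \<open>The second fragment is chosen first: its entry \<open>p2\<close> is the exit of
    the first one, which then has to avoid \<open>V2\<close>.\<close>
  with assms(2) obtain T2 V2 p2 where 2: "finite T2" "finite V2" "V2 \<inter> F = {}" "V2 \<subseteq> work_states"
    "p2 \<in> V2" "fst ` T2 \<subseteq> V2" "(snd \<circ> snd) ` T2 \<subseteq> insert q V2"
    "\<And>T'. agree V2 T2 T' \<Longrightarrow> simulates T' p2 q E"
    by (rule definableE[where q = q]) blast
  have "finite (F \<union> V2)"
    using \<open>finite F\<close> 2 by simp
  with assms(1) obtain T1 V1 p1 where 1: "finite T1" "finite V1" "V1 \<inter> (F \<union> V2) = {}"
    "V1 \<subseteq> work_states" "p1 \<in> V1" "fst ` T1 \<subseteq> V1" "(snd \<circ> snd) ` T1 \<subseteq> insert p2 V1"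
    "\<And>T'. agree V1 T1 T' \<Longrightarrow> simulates T' p1 p2 D"
    by (rule definableE[where q = p2]) blast
  have "simulates T' p1 q (D O E)" if "agree (V1 \<union> V2) (T1 \<union> T2) T'" for T'
  proof -
    from 1 have "V1 \<inter> V2 = {}" by auto
    from agree_Un[OF that this] 1 2 show ?thesis
      by (metis simulates_comp)
  qed
  then show "\<exists>T V p. finite T \<and> finite V \<and> V \<inter> F = {} \<and> V \<subseteq> work_states \<and> p \<in> V \<and>
     fst ` T \<subseteq> V \<and> (snd \<circ> snd) ` T \<subseteq> insert q V \<and>
     (\<forall>T'. agree V T T' \<longrightarrow> simulates T' p q (D O E))"
    using 1 2 by (intro exI[of _ "T1 \<union> T2"] exI[of _ "V1 \<union> V2"] exI[of _ p1]) auto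
qed

text \<open>An accepting run from the loop head \<open>p\<close> starts in the body or in the exit
  fragment. A pass through the body leaves a strictly shorter accepting run from \<open>p\<close>,
  hence the induction on the length. Conversely, iterations are put in front of an accepting run one
  by one.\<close>

lemma simulates_star:
  assumes E: "simulates T p2 q E" and D: "simulates T p1 p D"
    and p: "\<And>n c. acc T n p c \<longleftrightarrow> acc T n p2 c \<or> acc T n p1 c"
  shows "simulates T p q (D\<^sup>* O E)"
  unfolding simulates_def
proof (intro conjI allI impI)
  fix n c assume "acc T n p c"
  then show "\<exists>c' m. (c, c') \<in> D\<^sup>* O E \<and> m < n \<and> acc T m q c'"
  proof (induction n arbitrary: c rule: less_induct)
    case (less n)
    consider "acc T n p2 c" | "acc T n p1 c"
      using less.prems p by blast
    then show ?case
    proof cases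
      case 1
      then show ?thesis
        using E unfolding simulates_def by blast
    next
      case 2
      then obtain c' m where 3: "(c, c') \<in> D" "m < n" "acc T m p c'"
        using D unfolding simulates_def by blast
      with less.IH obtain c'' k where "(c', c'') \<in> D\<^sup>* O E" "k < m" "acc T k q c''"
        by blast
      with 3 have "(c, c'') \<in> D\<^sup>* O E" "k < n" "acc T k q c''"
        by (auto intro: converse_rtrancl_into_rtrancl)
      then show ?thesis by blast
    qed
  qed
next
  fix n c c'' assume "(c, c'') \<in> D\<^sup>* O E" "acc T n q c''"
  then obtain c' where c': "(c, c') \<in> D\<^sup>*" "(c', c'') \<in> E"
    by blast
  then have "\<exists>m. acc T m p c'"
    using E p \<open>acc T n q c''\<close> unfolding simulates_def by blast
  with c'(1) show "\<exists>m. acc T m p c"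
  proof (induction rule: converse_rtrancl_induct)
    case base
    then show ?case .
  next
    case (step x y)
    then show ?case
      using D p unfolding simulates_def by blast
  qed
qed

text \<open>The star comes with a continuation \<open>E\<close>, because leaving the loop without
  reading would be a silent step.\<close>

lemma definable_star:
  assumes "definable D" "definable E"
  shows "definable (D\<^sup>* O E)"
  unfolding definable_def
proof (intro allI impI)
  fix F :: "nat set" and q
  assume "finite F"
  \<comment> \<open>The loop head is fixed before both fragments, as it is the exit of the
    body.\<close>
  then obtain p where p: "p \<in> work_states" "p \<notin> F"
    by (rule fresh_work_state)
  have "finite (insert p F)"
    using \<open>finite F\<close> by simp
  with assms(2) obtain T2 V2 p2 where 2: "finite T2" "finite V2" "V2 \<inter> insert p F = {}"
    "V2 \<subseteq> work_states"
    "p2 \<in> V2" "fst ` T2 \<subseteq> V2" "(snd \<circ> snd) ` T2 \<subseteq> insert q V2"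
    "\<And>T'. agree V2 T2 T' \<Longrightarrow> simulates T' p2 q E"
    by (rule definableE[where q = q]) blast
  have "finite (insert p F \<union> V2)"
    using \<open>finite F\<close> 2 by simp
  with assms(1) obtain T1 V1 p1 where 1: "finite T1" "finite V1" "V1 \<inter> (insert p F \<union> V2) = {}"
    "V1 \<subseteq> work_states" "p1 \<in> V1" "fst ` T1 \<subseteq> V1" "(snd \<circ> snd) ` T1 \<subseteq> insert p V1"
    "\<And>T'. agree V1 T1 T' \<Longrightarrow> simulates T' p1 p D"
    by (rule definableE[where q = p]) blast
  \<comment> \<open>The loop head copies the first transitions of \<open>p1\<close> and
    \<open>p2\<close> in place of silent moves to them.\<close>
  define T0 where "T0 = (\<lambda>t. (p, snd t)) ` {t \<in> T1 \<union> T2. fst t = p1 \<or> fst t = p2}"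
  have disj: "V1 \<inter> V2 = {}" "p \<notin> V1 \<union> V2"
    using 1 2 by auto
  have T0: "(p, l, x) \<in> T0 \<longleftrightarrow> (p2, l, x) \<in> T2 \<or> (p1, l, x) \<in> T1" for l x
  proof -
    have "p1 \<notin> V2" "p2 \<notin> V1"
      using 1(5) 2(5) disj by auto
    then have "(p1, l, x) \<notin> T2" "(p2, l, x) \<notin> T1"
      using 1(6) 2(6) by (auto simp: image_subset_iff)
    moreover have "(p, l, x) \<in> T0 \<longleftrightarrow> (p1, l, x) \<in> T1 \<union> T2 \<or> (p2, l, x) \<in> T1 \<union> T2"
      unfolding T0_def by (cases l) (force simp: image_iff)
    ultimately show ?thesis
      by blast
  qed
  have T12: "(p, l, x) \<notin> T1" "(p, l, x) \<notin> T2" for l x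
    using 1(6) 2(6) disj by (auto simp: image_subset_iff)
  have T0': "fst ` T0 \<subseteq> {p}" "finite T0" "(snd \<circ> snd) ` T0 \<subseteq> (snd \<circ> snd) ` (T1 \<union> T2)"
    using 1(1) 2(1) by (auto simp: T0_def intro: rev_image_eqI)
  have "simulates T' p q (D\<^sup>* O E)" if "agree ({p} \<union> (V1 \<union> V2)) (T0 \<union> (T1 \<union> T2)) T'" for T'
  proof (rule simulates_star)
    have a: "agree {p} T0 T'" "agree (V1 \<union> V2) (T1 \<union> T2) T'"
      using that disj(2) T0' 1(6) 2(6) by (auto intro!: agree_Un[OF that])
    then have b: "agree V1 T1 T'" "agree V2 T2 T'"
      using disj(1) 1(6) 2(6) by (auto intro!: agree_Un[OF a(2)])
    show "simulates T' p2 q E" "simulates T' p1 p D"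
      using 1(8) 2(8) b by auto
    show "acc T' n p c \<longleftrightarrow> acc T' n p2 c \<or> acc T' n p1 c" for n c
    proof (rule acc_Un)
      show "(p, l, x) \<in> T' \<longleftrightarrow> (p2, l, x) \<in> T' \<or> (p1, l, x) \<in> T'" for l x
        using a(1) b 1(5) 2(5) T0 unfolding agree_def by blast
      show "p \<noteq> 1" "p1 \<noteq> 1" "p2 \<noteq> 1"
        using p(1) 1(4,5) 2(4,5) not_one_work by auto
    qed
  qed
  moreover have "(snd \<circ> snd) ` (T0 \<union> (T1 \<union> T2)) \<subseteq> insert q ({p} \<union> (V1 \<union> V2))"
  proof -
    have "(snd \<circ> snd) ` (T0 \<union> (T1 \<union> T2)) \<subseteq> (snd \<circ> snd) ` T1 \<union> (snd \<circ> snd) ` T2"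
      using T0'(3) by (simp only: image_Un) simp
    then show ?thesis
      using 1(7) 2(7) by fast
  qed
  ultimately show "\<exists>T V p. finite T \<and> finite V \<and> V \<inter> F = {} \<and> V \<subseteq> work_states \<and> p \<in> V \<and>
     fst ` T \<subseteq> V \<and> (snd \<circ> snd) ` T \<subseteq> insert q V \<and>
     (\<forall>T'. agree V T T' \<longrightarrow> simulates T' p q (D\<^sup>* O E))"
    using 1(1-6) 2(1-6) p T0'(1,2)
    by (intro exI[of _ "T0 \<union> (T1 \<union> T2)"] exI[of _ "{p} \<union> (V1 \<union> V2)"] exI[of _ p]) auto
qed

section \<open>Stacks in the queue between the heads\<close>

text \<open>Unary blocks with a terminator: one letter tells whether the front entry is zero, and a
  finite automaton can copy an entry digit by digit.\<close>

definition enc_stack :: "nat list \<Rightarrow> bool list" where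
  "enc_stack s = concat (map (\<lambda>x. replicate x True @ [False]) s)"

lemma enc_stack_simps [simp]:
  "enc_stack [] = []"
  "enc_stack (0 # s) = False # enc_stack s"
  "enc_stack (Suc x # s) = True # enc_stack (x # s)"
  "enc_stack (s @ t) = enc_stack s @ enc_stack t"
  by (simp_all add: enc_stack_def)

text \<open>Both heads read the same word; \<^term>\<open>a\<close> is what the leading head has not read yet. The text between
  the two heads, which acts as a queue, holds the stack.\<close>

definition stack_rel :: "nat \<Rightarrow> nat list rel \<Rightarrow> streams rel \<Rightarrow> bool" where
  "stack_rel N R D \<longleftrightarrow>
     (\<forall>s a a' b'. length s = N \<longrightarrow> ((a, enc_stack s @ a), (a', b')) \<in> D \<longrightarrow>
        (\<exists>s'. (s, s') \<in> R \<and> b' = enc_stack s' @ a')) \<and>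
     (\<forall>s s' a'. (s, s') \<in> R \<longrightarrow> (\<exists>a. ((a, enc_stack s @ a), (a', enc_stack s' @ a')) \<in> D))"

lemma stack_relD1:
  assumes "stack_rel N R D" "length s = N" "((a, enc_stack s @ a), (a', b')) \<in> D"
  shows "\<exists>s'. (s, s') \<in> R \<and> b' = enc_stack s' @ a'"
  using assms unfolding stack_rel_def by blast

lemma stack_relD2:
  assumes "stack_rel N R D" "(s, s') \<in> R"
  shows "\<exists>a. ((a, enc_stack s @ a), (a', enc_stack s' @ a')) \<in> D"
  using assms unfolding stack_rel_def by blast

text \<open>The lengths belong to the notion because entries are addressed by rotating the queue,
  and a finite automaton has to know the number of entries for that.\<close>

definition stack_definable :: "nat \<Rightarrow> nat \<Rightarrow> nat list rel \<Rightarrow> bool" where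
  "stack_definable N M R \<longleftrightarrow> R \<subseteq> {s. length s = N} \<times> {s. length s = M} \<and>
     (\<exists>D. definable D \<and> stack_rel N R D)"

lemma stack_definableI:
  assumes "definable D" "R \<subseteq> {s. length s = N} \<times> {s. length s = M}"
    "\<And>s a a' b'. length s = N \<Longrightarrow> ((a, enc_stack s @ a), (a', b')) \<in> D \<Longrightarrow>
       \<exists>s'. (s, s') \<in> R \<and> b' = enc_stack s' @ a'"
    "\<And>s s' a'. (s, s') \<in> R \<Longrightarrow> \<exists>a. ((a, enc_stack s @ a), (a', enc_stack s' @ a')) \<in> D"
  shows "stack_definable N M R"
  unfolding stack_definable_def stack_rel_def
  using assms by (intro conjI exI[of _ D]) simp_all

lemma stack_definableE:
  assumes "stack_definable N M R"
  obtains D where "definable D" "R \<subseteq> {s. length s = N} \<times> {s. length s = M}" "stack_rel N R D"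
  using assms unfolding stack_definable_def by blast

lemma stack_definable_length:
  assumes "stack_definable N M R" "(s, s') \<in> R"
  shows "length s = N" "length s' = M"
  using assms unfolding stack_definable_def by auto

lemma stack_definable_empty: "stack_definable N M {}"
  by (rule stack_definableI[OF definable_empty]) auto

lemma stack_definable_comp:
  assumes "stack_definable N M R" "stack_definable M K S"
  shows "stack_definable N K (R O S)"
proof -
  obtain D where D: "definable D" "R \<subseteq> {s. length s = N} \<times> {s. length s = M}" "stack_rel N R D"
    using assms(1) by (rule stack_definableE)
  obtain E where E: "definable E" "S \<subseteq> {s. length s = M} \<times> {s. length s = K}" "stack_rel M S E"
    using assms(2) by (rule stack_definableE)
  show ?thesis
  proof (rule stack_definableI[OF definable_comp[OF D(1) E(1)]])
    show "R O S \<subseteq> {s. length s = N} \<times> {s. length s = K}"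
      using D(2) E(2) by auto
  next
    fix s a a'' b''
    assume s: "length s = N" and "((a, enc_stack s @ a), (a'', b'')) \<in> D O E"
    then obtain a' b' where 1: "((a, enc_stack s @ a), (a', b')) \<in> D" "((a', b'), (a'', b'')) \<in> E"
      by auto
    with stack_relD1[OF D(3) s] obtain s' where s': "(s, s') \<in> R" "b' = enc_stack s' @ a'"
      by blast
    with D(2) 1(2) stack_relD1[OF E(3)] obtain s'' where "(s', s'') \<in> S" "b'' = enc_stack s'' @ a''"
      by blast
    with s' show "\<exists>s'. (s, s') \<in> R O S \<and> b'' = enc_stack s' @ a''"
      by blast
  next
    fix s s'' a'' assume "(s, s'') \<in> R O S"
    then show "\<exists>a. ((a, enc_stack s @ a), (a'', enc_stack s'' @ a'')) \<in> D O E"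
      using stack_relD2[OF D(3)] stack_relD2[OF E(3)] by (meson relcomp.cases relcompI)
  qed
qed

lemma stack_definable_star:
  assumes "stack_definable N N R" "stack_definable N M S"
  shows "stack_definable N M (R\<^sup>* O S)"
proof -
  obtain D where D: "definable D" "R \<subseteq> {s. length s = N} \<times> {s. length s = N}" "stack_rel N R D"
    using assms(1) by (rule stack_definableE)
  obtain E where E: "definable E" "S \<subseteq> {s. length s = N} \<times> {s. length s = M}" "stack_rel N S E"
    using assms(2) by (rule stack_definableE)
  show ?thesis
  proof (rule stack_definableI[OF definable_star[OF D(1) E(1)]])
    show "R\<^sup>* O S \<subseteq> {s. length s = N} \<times> {s. length s = M}"
    proof -
      have "length s' = N \<Longrightarrow> length s = N" if "(s, s') \<in> R\<^sup>*" for s s'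
        using that D(2) by (induction rule: converse_rtrancl_induct) auto
      then show ?thesis
        using E(2) by auto
    qed
  next
    fix s a a'' b''
    assume s: "length s = N" and "((a, enc_stack s @ a), (a'', b'')) \<in> D\<^sup>* O E"
    then obtain c' where 1: "((a, enc_stack s @ a), c') \<in> D\<^sup>*" "(c', (a'', b'')) \<in> E"
      by auto
    from 1(1) have "\<exists>s'. (s, s') \<in> R\<^sup>* \<and> length s' = N \<and> snd c' = enc_stack s' @ fst c'"
    proof (induction rule: rtrancl_induct)
      case base
      then show ?case using s by auto
    next
      case (step y z)
      then obtain s' where s': "(s, s') \<in> R\<^sup>*" "length s' = N" "snd y = enc_stack s' @ fst y"
        by blast
      then have "((fst y, enc_stack s' @ fst y), (fst z, snd z)) \<in> D"
        using step.hyps(2) by (metis prod.collapse)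
      then obtain s'' where "(s', s'') \<in> R" "snd z = enc_stack s'' @ fst z"
        using stack_relD1[OF D(3) s'(2)] by blast
      then show ?case
        using s' D(2) by (blast intro: rtrancl_into_rtrancl)
    qed
    then obtain s' where s': "(s, s') \<in> R\<^sup>*" "length s' = N" "c' = (fst c', enc_stack s' @ fst c')"
      by (metis prod.collapse)
    with stack_relD1[OF E(3) s'(2)] 1(2) show "\<exists>s'. (s, s') \<in> R\<^sup>* O S \<and> b'' = enc_stack s' @ a''"
      by (metis relcompI)
  next
    fix s s'' a'' assume "(s, s'') \<in> R\<^sup>* O S"
    then obtain s' where s': "(s, s') \<in> R\<^sup>*" "(s', s'') \<in> S"
      by blast
    \<comment> \<open>The word is guessed backwards: what remains after \<open>E\<close> determines
      what has to remain before it, and likewise for each iteration down to the first.\<close>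
    then obtain a' where a': "((a', enc_stack s' @ a'), (a'', enc_stack s'' @ a'')) \<in> E"
      using stack_relD2[OF E(3)] by blast
    from s'(1) have "\<exists>a. ((a, enc_stack s @ a), (a', enc_stack s' @ a')) \<in> D\<^sup>*"
    proof (induction rule: converse_rtrancl_induct)
      case base
      then show ?case by blast
    next
      case (step y z)
      then show ?case
        using stack_relD2[OF D(3)] by (meson converse_rtrancl_into_rtrancl)
    qed
    then show "\<exists>a. ((a, enc_stack s @ a), (a'', enc_stack s'' @ a'')) \<in> D\<^sup>* O E"
      using a' by blast
  qed
qed

section \<open>Queue operations: rotating, testing and changing single entries\<close>

definition enq :: "bool \<Rightarrow> streams rel" where
  "enq x = {(c, c'). reads (True, x) c c'}"

definition deq :: "bool \<Rightarrow> streams rel" where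
  "deq x = {(c, c'). reads (False, x) c c'}"

lemma definable_enq: "definable (enq x)" and definable_deq: "definable (deq x)"
  unfolding enq_def deq_def by (rule definable_letter)+

lemma enq_iff [simp]: "((a, b), (a', b')) \<in> enq x \<longleftrightarrow> a = x # a' \<and> b' = b"
  and deq_iff [simp]: "((a, b), (a', b')) \<in> deq x \<longleftrightarrow> b = x # b' \<and> a' = a"
  by (auto simp: enq_def deq_def)

lemma stack_push_back:
  "stack_definable N (Suc N) {(s, s @ [0]) | s. length s = N}"
  by (rule stack_definableI[OF definable_enq[of False]]) auto

lemma stack_dec_front:
  "stack_definable (Suc N) (Suc N) {(Suc x # s, x # s) | x s. length s = N}"
proof (rule stack_definableI[OF definable_deq[of True]], goal_cases)
  case (2 s a a' b')
  then obtain x t where "s = x # t" "length t = N"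
    by (cases s) auto
  with 2 show ?case
    by (cases x) auto
qed auto

lemma stack_pop_front:
  "stack_definable (Suc N) N {(0 # s, s) | s. length s = N}"
proof (rule stack_definableI[OF definable_deq[of False]], goal_cases)
  case (2 s a a' b')
  then obtain x t where "s = x # t" "length t = N"
    by (cases s) auto
  with 2 show ?case
    by (cases x) auto
qed auto

text \<open>Moves one unary digit from the front of the queue to its back.\<close>

definition copy_unary :: "streams rel" where
  "copy_unary = deq True O enq True"

lemma copy_unary_iff [simp]:
  "((a, b), (a', b')) \<in> copy_unary \<longleftrightarrow> b = True # b' \<and> a = True # a'"
  by (force simp: copy_unary_def relcomp_unfold)

lemma copy_unary_star:
  "(c, c') \<in> copy_unary\<^sup>* \<longleftrightarrow>
   (\<exists>n. fst c = replicate n True @ fst c' \<and> snd c = replicate n True @ snd c')"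
proof
  assume "(c, c') \<in> copy_unary\<^sup>*"
  then show "\<exists>n. fst c = replicate n True @ fst c' \<and> snd c = replicate n True @ snd c'"
  proof (induction rule: converse_rtrancl_induct)
    case base
    show ?case by (rule exI[of _ 0]) simp
  next
    case (step y z)
    then obtain n where "fst z = replicate n True @ fst c'" "snd z = replicate n True @ snd c'"
      by blast
    with step.hyps(1) show ?case
      by (intro exI[of _ "Suc n"]) (cases y; cases z; auto)
  qed
next
  assume "\<exists>n. fst c = replicate n True @ fst c' \<and> snd c = replicate n True @ snd c'"
  then obtain n where "fst c = replicate n True @ fst c'" "snd c = replicate n True @ snd c'"
    by blast
  then show "(c, c') \<in> copy_unary\<^sup>*"
  proof (induction n arbitrary: c)
    case 0
    then have "c = c'" by (simp add: prod_eq_iff)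
    then show ?case by simp
  next
    case (Suc n)
    have "(c, (replicate n True @ fst c', replicate n True @ snd c')) \<in> copy_unary"
      using Suc.prems by (cases c) simp
    then show ?case
      by (rule converse_rtrancl_into_rtrancl) (simp add: Suc.IH)
  qed
qed

lemma enc_stack_Cons: "enc_stack (x # s) = replicate x True @ False # enc_stack s"
  by (simp add: enc_stack_def)

lemma replicate_True_eq_iff:
  "replicate x True @ False # u = replicate y True @ False # v \<longleftrightarrow> x = y \<and> u = v"
proof (induction x arbitrary: y)
  case 0
  then show ?case by (cases y) auto
next
  case (Suc x)
  then show ?case by (cases y) auto
qed

text \<open>The front block is copied digit by digit to the back; then \<open>E\<close> drops the
  old terminator and appends \<open>k\<close> further digits and a new terminator.\<close>

lemma stack_rotate_gen:
  assumes "definable E"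
    and E: "\<And>a b a' b'. ((a, b), (a', b')) \<in> E \<longleftrightarrow> b = False # b' \<and> a = replicate k True @ False # a'"
  shows "stack_definable (Suc N) (Suc N) {(x # s, s @ [x + k]) | x s. length s = N}"
proof (rule stack_definableI[OF definable_star[OF _ assms(1)]])
  show "definable copy_unary"
    unfolding copy_unary_def by (intro definable_comp definable_enq definable_deq)
next
  fix s a a' b'
  assume "length s = Suc N" and "((a, enc_stack s @ a), (a', b')) \<in> copy_unary\<^sup>* O E"
  moreover from this(1) obtain x t where s: "s = x # t" "length t = N"
    by (cases s) auto
  ultimately obtain n where n: "enc_stack (x # t) @ a = replicate n True @ False # b'"
    "a = replicate n True @ replicate k True @ False # a'"
    by (force simp: relcomp_unfold copy_unary_star E)
  \<comment> \<open>The terminator fixes the number of iterations: after fewer of them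
    \<open>E\<close> would meet \<open>True\<close> instead of \<open>False\<close>, and the loop
    cannot pass a \<open>False\<close>.\<close>
  then have "n = x" "b' = enc_stack t @ a"
    by (simp_all add: enc_stack_Cons replicate_True_eq_iff)
  with n(2) have "b' = enc_stack (t @ [x + k]) @ a'"
    by (simp add: enc_stack_Cons replicate_add)
  with s show "\<exists>s'. (s, s') \<in> {(x # s, s @ [x + k]) | x s. length s = N} \<and> b' = enc_stack s' @ a'"
    by blast
next
  fix s s' a' assume "(s, s') \<in> {(x # s, s @ [x + k]) | x s. length s = N}"
  then obtain x t where s: "s = x # t" "s' = t @ [x + k]"
    by blast
  define a where "a = replicate k True @ False # a'"
  define b where "b = enc_stack t @ replicate x True @ a"
  have "((replicate x True @ a, enc_stack s @ replicate x True @ a), (a, False # b)) \<in> copy_unary\<^sup>*"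
    unfolding copy_unary_star by (rule exI[of _ x]) (simp add: s enc_stack_Cons b_def)
  moreover have "((a, False # b), (a', b)) \<in> E"
    by (simp add: E a_def)
  moreover have "b = enc_stack s' @ a'"
    by (simp add: b_def a_def s enc_stack_Cons replicate_add)
  ultimately show "\<exists>a. ((a, enc_stack s @ a), (a', enc_stack s' @ a')) \<in> copy_unary\<^sup>* O E"
    by blast
qed auto

lemma stack_rotate1: "stack_definable (Suc N) (Suc N) {(x # s, s @ [x]) | x s. length s = N}"
proof -
  have "((a, b), (a', b')) \<in> deq False O enq False \<longleftrightarrow>
    b = False # b' \<and> a = replicate 0 True @ False # a'" for a b a' b'
    by (force simp: relcomp_unfold)
  from stack_rotate_gen[OF _ this, of N] show ?thesis
    by (simp add: definable_comp definable_enq definable_deq)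
qed

lemma stack_rotate1_inc:
  "stack_definable (Suc N) (Suc N) {(x # s, s @ [Suc x]) | x s. length s = N}"
proof -
  have "((a, b), (a', b')) \<in> enq True O deq False O enq False \<longleftrightarrow>
    b = False # b' \<and> a = replicate (Suc 0) True @ False # a'" for a b a' b'
    by (force simp: relcomp_unfold)
  from stack_rotate_gen[OF _ this, of N] show ?thesis
    by (simp add: definable_comp definable_enq definable_deq)
qed

lemma stack_definable_cong:
  assumes "stack_definable N M R" "N = N'" "M = M'" "R = S"
  shows "stack_definable N' M' S"
  using assms by simp

text \<open>The count starts at one rotation, since zero rotations would be an empty program. For a
  nonempty stack the full turn then serves as the identity.\<close>

lemma stack_rotate_Suc:
  "stack_definable (Suc N) (Suc N) {(s, rotate (Suc i) s) | s. length s = Suc N}"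
proof (induction i)
  case 0
  show ?case
    by (rule stack_definable_cong[OF stack_rotate1[of N]]) (auto simp: length_Suc_conv)
next
  case (Suc i)
  have 1: "stack_definable (Suc N) (Suc N) {(s, rotate1 s) | s. length s = Suc N}"
    by (rule stack_definable_cong[OF stack_rotate1[of N]]) (auto simp: length_Suc_conv)
  show ?case
    by (rule stack_definable_cong[OF stack_definable_comp[OF Suc 1]]) (auto simp: relcomp_unfold)
qed

text \<open>A silent step is not available, so even the identity has to rotate the whole queue once.\<close>

lemma stack_id: "stack_definable N N {(s, s) | s. length s = N}"
proof (cases N)
  case 0
  show ?thesis
    unfolding 0
    by (rule stack_definable_cong[OF stack_definable_comp[OF stack_push_back[of 0] stack_pop_front[of 0]]])
      auto
next
  case (Suc n)
  show ?thesis
    by (rule stack_definable_cong[OF stack_rotate_Suc[of n n]]) (auto simp: Suc rotate_id simp del: rotate_Suc)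
qed

lemma stack_rotate:
  "stack_definable (i + j) (i + j) {(u @ v, v @ u) | u v. length u = i \<and> length v = j}"
proof -
  have "stack_definable (i + j) (i + j) {(s, rotate i s) | s. length s = i + j}"
    using stack_rotate_Suc[of "i - 1 + j" "i - 1"] stack_id[of j] by (cases i) simp_all
  moreover have "{(s, rotate i s) | s. length s = i + j} =
    {(u @ v :: nat list, v @ u) | u v. length u = i \<and> length v = j}"
  proof (intro set_eqI iffI)
    fix x :: "nat list \<times> nat list"
    assume "x \<in> {(s, rotate i s) | s. length s = i + j}"
    then obtain s where s: "x = (s, rotate i s)" "length s = i + j"
      by blast
    have "rotate i (take i s @ drop i s) = drop i s @ take i s"
      using s(2) rotate_append[of "take i s" "drop i s"] by simp
    then show "x \<in> {(u @ v, v @ u) | u v. length u = i \<and> length v = j}"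
      using s by (intro CollectI exI[of _ "take i s"] exI[of _ "drop i s"]) simp
  next
    fix x :: "nat list \<times> nat list"
    assume "x \<in> {(u @ v, v @ u) | u v. length u = i \<and> length v = j}"
    then obtain u v where "x = (u @ v, v @ u)" "length u = i" "length v = j"
      by auto
    then show "x \<in> {(s, rotate i s) | s. length s = i + j}"
      by (intro CollectI exI[of _ "u @ v"]) (auto simp: rotate_append)
  qed
  ultimately show ?thesis
    by simp
qed

text \<open>Conjugation by rotations: \<open>i\<close> entries are turned to the back, the operation
  consumes the front entry \<open>f x\<close> and appends \<open>g x\<close>, and turning the next
  \<open>j\<close> entries restores the order. \<open>f\<close> acts as a pattern: an entry outside
  its range has no successor, which is how tests are expressed.\<close>

lemma stack_at:
  fixes f :: "nat \<Rightarrow> nat" and g :: "nat \<Rightarrow> nat list"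
  assumes R: "stack_definable (Suc (i + j)) (k + i + j)
      {(f x # s, s @ g x) | x s. length s = i + j}"
    and g: "\<And>x. length (g x) = k"
  shows "stack_definable (Suc (i + j)) (k + i + j)
      {(u @ f x # v, u @ g x @ v) | x u v. length u = i \<and> length v = j}"
    (is "stack_definable _ _ ?S")
proof -
  let ?A = "{(u @ v, v @ u) | u v. length u = i \<and> length v = Suc j} :: nat list rel"
  let ?R = "{(f x # s, s @ g x) | x s. length s = i + j}"
  let ?B = "{(u @ v, v @ u) | u v. length u = j \<and> length v = k + i} :: nat list rel"
  have 1: "(u @ f x # v, u @ g x @ v) \<in> ?A O ?R O ?B"
    if "length u = i" "length v = j" for u v x
  proof (intro relcompI)
    show "(u @ f x # v, f x # (v @ u)) \<in> ?A"
      using that by (intro CollectI exI[of _ u] exI[of _ "f x # v"]) simp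
    show "(f x # (v @ u), v @ (u @ g x)) \<in> ?R"
      using that by (intro CollectI exI[of _ x] exI[of _ "v @ u"]) simp
    show "(v @ (u @ g x), u @ g x @ v) \<in> ?B"
      using that g by (intro CollectI exI[of _ v] exI[of _ "u @ g x"]) simp
  qed
  have 2: "(s, s') \<in> ?S" if AB: "(s, s') \<in> ?A O ?R O ?B" for s s'
  proof -
    from AB obtain s1 s2 where "(s, s1) \<in> ?A" "(s1, s2) \<in> ?R" "(s2, s') \<in> ?B"
      by (elim relcompE) simp
    then obtain u w x t v y where 1: "s = u @ w" "length u = i" "length w = Suc j"
      "w @ u = f x # t" "length t = i + j" "t @ g x = v @ y" "s' = y @ v"
      "length v = j" "length y = k + i"
      by blast
    then obtain w' where w: "w = f x # w'" "t = w' @ u"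
      by (cases w) auto
    with 1 have "v = w'" "y = u @ g x"
      by simp_all
    with 1 w have "s = u @ f x # v" "s' = u @ g x @ v"
      by simp_all
    with 1 show ?thesis
      by blast
  qed
  have "?A O ?R O ?B = ?S"
  proof (intro equalityI subrelI)
    fix s s' assume "(s, s') \<in> ?S"
    then obtain x u v where "s = u @ f x # v" "s' = u @ g x @ v" "length u = i" "length v = j"
      by blast
    with 1 show "(s, s') \<in> ?A O ?R O ?B"
      by simp
  qed (rule 2)
  moreover have "stack_definable (Suc (i + j)) (k + i + j) (?A O ?R O ?B)"
    using stack_rotate[of i "Suc j"] R stack_rotate[of j "k + i"]
    by (intro stack_definable_comp[where M = "Suc (i + j)"] stack_definable_comp[where M = "k + i + j"])
      (simp_all add: ac_simps)
  ultimately show ?thesis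
    by simp
qed

lemma stack_inc:
  "stack_definable (Suc (i + j)) (Suc (i + j))
     {(u @ x # v, u @ Suc x # v) | x u v. length u = i \<and> length v = j}"
  using stack_at[of i j 1 "\<lambda>x. x" "\<lambda>x. [Suc x]"] stack_rotate1_inc[of "i + j"] by simp

lemma stack_pop:
  "stack_definable (Suc (i + j)) (i + j)
     {(u @ 0 # v, u @ v) | u v. length u = i \<and> length v = j}"
  using stack_at[of i j 0 "\<lambda>_. 0" "\<lambda>_. []"] stack_pop_front[of "i + j"] by simp

lemma stack_test:
  "stack_definable (Suc (i + j)) (Suc (i + j))
     {(u @ 0 # v, u @ 0 # v) | u v. length u = i \<and> length v = j}"
proof -
  have "stack_definable (Suc (i + j)) (Suc (i + j)) {(0 # s, s @ [0]) | s. length s = i + j}"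
    by (rule stack_definable_cong[OF stack_definable_comp[OF stack_pop_front stack_push_back]])
      auto
  then show ?thesis
    using stack_at[of i j 1 "\<lambda>_. 0" "\<lambda>_. [0]"] by simp
qed

lemma stack_dec:
  "stack_definable (Suc (i + j)) (Suc (i + j))
     {(u @ Suc x # v, u @ x # v) | x u v. length u = i \<and> length v = j}"
proof -
  have "stack_definable (Suc (i + j)) (Suc (i + j)) {(Suc x # s, s @ [x]) | x s. length s = i + j}"
    by (rule stack_definable_cong[OF stack_definable_comp[OF stack_dec_front stack_rotate1]])
      auto
  then show ?thesis
    using stack_at[of i j 1 "Suc" "\<lambda>x. [x]"] by simp
qed

lemma stack_push: "stack_definable N (Suc N) {(s, 0 # s) | s. length s = N}"
proof -
  have "stack_definable (Suc N) (Suc N) {(u @ v, v @ u) | u v. length u = N \<and> length v = 1}"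
    using stack_rotate[of N 1] by simp
  from stack_definable_comp[OF stack_push_back this] show ?thesis
  proof (rule stack_definable_cong)
    show "{(s, s @ [0]) | s. length s = N} O {(u @ v, v @ u) | u v. length u = N \<and> length v = 1} =
      {(s, 0 # s) | s. length s = N}" (is "?A O ?B = ?C")
    proof (intro set_eqI iffI)
      fix x assume "x \<in> ?A O ?B"
      then obtain s u v where "x = (s, v @ u)" "s @ [0] = u @ v" "length u = N" "length v = 1"
          "length s = N"
        by blast
      then show "x \<in> ?C"
        by simp
    next
      fix x assume "x \<in> ?C"
      then obtain s where x: "x = (s, 0 # s)" "length s = N"
        by blast
      have "(s, s @ [0]) \<in> ?A"
        using x(2) by blast
      moreover have "(s @ [0], 0 # s) \<in> ?B"
        using x(2) by (intro CollectI exI[of _ s] exI[of _ "[0]"]) simp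
      ultimately show "x \<in> ?A O ?B"
        unfolding x(1) by (rule relcompI)
    qed
  qed simp_all
qed

section \<open>Counter programs on stacks of fixed length\<close>

definition pfun :: "nat \<Rightarrow> (nat list \<Rightarrow> bool) \<Rightarrow> (nat list \<Rightarrow> nat list) \<Rightarrow> nat list rel" where
  "pfun N P f = {(s, s'). length s = N \<and> P s \<and> s' = f s}"

lemma pfun_iff [simp]: "(s, s') \<in> pfun N P f \<longleftrightarrow> length s = N \<and> P s \<and> s' = f s"
  by (simp add: pfun_def)

lemma pfunE:
  assumes "y \<in> pfun N P f"
  obtains s where "y = (s, f s)" "length s = N" "P s"
  using assms by (auto simp: pfun_def)

lemma stack_definable_pfun_cong:
  assumes "stack_definable N M (pfun N P f)" "\<And>s. length s = N \<Longrightarrow> P s \<longleftrightarrow> Q s"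
    "\<And>s. length s = N \<Longrightarrow> P s \<Longrightarrow> f s = g s"
  shows "stack_definable N M (pfun N Q g)"
  by (rule stack_definable_cong[OF assms(1)]) (use assms(2,3) in auto)

lemma stack_definable_pfun_comp:
  assumes "stack_definable N M (pfun N P f)" "stack_definable M K (pfun M Q g)"
  shows "stack_definable N K (pfun N (\<lambda>s. P s \<and> Q (f s)) (\<lambda>s. g (f s)))"
proof -
  have "length (f s) = M" if "length s = N" "P s" for s
    using stack_definable_length(2)[OF assms(1), of s "f s"] that by simp
  then show ?thesis
    by (intro stack_definable_cong[OF stack_definable_comp[OF assms]]) auto
qed

text \<open>The guards make the nondeterministic star deterministic: the body demands a nonzero
  counter and the continuation a zero one, so exactly \<open>r s\<close> iterations take
  place.\<close>

lemma stack_definable_loop: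
  assumes D: "stack_definable N N (pfun N (\<lambda>s. r s \<noteq> 0) f)"
    and E: "stack_definable N M (pfun N (\<lambda>s. r s = 0) g)"
    and r: "\<And>s. length s = N \<Longrightarrow> r s \<noteq> 0 \<Longrightarrow> r (f s) = r s - (1 :: nat)"
  shows "stack_definable N M (pfun N (\<lambda>s. True) (\<lambda>s. g ((f ^^ r s) s)))"
proof -
  have len: "length (f s) = N" if "length s = N" "r s \<noteq> 0" for s
    using stack_definable_length(2)[OF D, of s "f s"] that by simp
  let ?D = "pfun N (\<lambda>s. r s \<noteq> 0) f" and ?E = "pfun N (\<lambda>s. r s = 0) g"
  \<comment> \<open>The target \<open>(f ^^ r s) s\<close> is invariant: an iteration performs one
    application of \<open>f\<close> and lowers the number of those still to come by one.\<close>
  have 1: "(f ^^ r s) s = (f ^^ r s') s' \<and> length s = N"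
    if "(s, s') \<in> ?D\<^sup>*" "length s' = N" for s s'
    using that
  proof (induction rule: converse_rtrancl_induct)
    case base
    then show ?case by simp
  next
    case (step s t)
    from step.hyps(1) have "r s \<noteq> 0" "t = f s" "length s = N"
      by simp_all
    then have "(f ^^ r s) s = (f ^^ r t) t"
      using r[of s] by (cases "r s") (simp_all add: funpow_swap1)
    with step.IH[OF step.prems] \<open>length s = N\<close> show ?case
      by simp
  qed
  have 2: "(s, (f ^^ r s) s) \<in> ?D\<^sup>* \<and> length ((f ^^ r s) s) = N \<and> r ((f ^^ r s) s) = 0"
    if "length s = N" for s
    using that
  proof (induction "r s" arbitrary: s)
    case 0
    then show ?case by simp
  next
    case (Suc n)
    then have f: "(s, f s) \<in> ?D" "length (f s) = N" "n = r (f s)" "r s = Suc n"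
      using len[of s] r[of s] by auto
    have "(f ^^ r s) s = (f ^^ r (f s)) (f s)"
      using f by (simp add: funpow_swap1)
    with Suc.hyps(1)[OF f(3,2)] f(1) show ?case
      by (auto intro: converse_rtrancl_into_rtrancl)
  qed
  show ?thesis
  proof (rule stack_definable_cong[OF stack_definable_star[OF D E]])
    show "?D\<^sup>* O ?E = pfun N (\<lambda>s. True) (\<lambda>s. g ((f ^^ r s) s))"
    proof (intro set_eqI iffI)
      fix x assume "x \<in> ?D\<^sup>* O ?E"
      then obtain s s' where "x = (s, g s')" "(s, s') \<in> ?D\<^sup>*" "length s' = N" "r s' = 0"
        by auto
      with 1[of s s'] show "x \<in> pfun N (\<lambda>s. True) (\<lambda>s. g ((f ^^ r s) s))"
        by simp
    next
      fix x assume "x \<in> pfun N (\<lambda>s. True) (\<lambda>s. g ((f ^^ r s) s))"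
      then obtain s where x: "x = (s, g ((f ^^ r s) s))" "length s = N"
        by (cases x) auto
      then have "((f ^^ r s) s, g ((f ^^ r s) s)) \<in> ?E"
        using 2[of s] by simp
      then show "x \<in> ?D\<^sup>* O ?E"
        using 2[of s] x by blast
    qed
  qed auto
qed

lemma split_at:
  assumes "i < length s"
  obtains u x v where "s = u @ x # v" "length u = i"
proof
  show "s = take i s @ s ! i # drop (Suc i) s"
    using assms by (simp add: id_take_nth_drop)
qed (use assms in auto)

lemma pfun_inc:
  assumes "i < N"
  shows "stack_definable N N (pfun N (\<lambda>s. True) (\<lambda>s. s[i := Suc (s ! i)]))"
proof (rule stack_definable_cong[OF stack_inc[of i "N - Suc i"]])
  show "{(u @ x # v, u @ Suc x # v) | x u v. length u = i \<and> length v = N - Suc i} =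
    pfun N (\<lambda>s. True) (\<lambda>s. s[i := Suc (s ! i)])"
  proof (intro set_eqI iffI)
    fix y assume "y \<in> pfun N (\<lambda>s. True) (\<lambda>s. s[i := Suc (s ! i)])"
    then obtain s where s: "y = (s, s[i := Suc (s ! i)])" "length s = N"
      by (rule pfunE)
    with assms obtain u x v where u: "s = u @ x # v" "length u = i"
      by (metis split_at)
    with s have "y = (u @ x # v, u @ Suc x # v)" "length v = N - Suc i"
      by (auto simp: nth_append list_update_append)
    with u show "y \<in> {(u @ x # v, u @ Suc x # v) | x u v. length u = i \<and> length v = N - Suc i}"
      by blast
  qed (use assms in \<open>auto simp: nth_append list_update_append\<close>)
qed (use assms in auto)

lemma pfun_dec:
  assumes "i < N"
  shows "stack_definable N N (pfun N (\<lambda>s. s ! i \<noteq> 0) (\<lambda>s. s[i := s ! i - 1]))"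
proof (rule stack_definable_cong[OF stack_dec[of i "N - Suc i"]])
  show "{(u @ Suc x # v, u @ x # v) | x u v. length u = i \<and> length v = N - Suc i} =
    pfun N (\<lambda>s. s ! i \<noteq> 0) (\<lambda>s. s[i := s ! i - 1])"
  proof (intro set_eqI iffI)
    fix y assume "y \<in> pfun N (\<lambda>s. s ! i \<noteq> 0) (\<lambda>s. s[i := s ! i - 1])"
    then obtain s where s: "y = (s, s[i := s ! i - 1])" "length s = N" "s ! i \<noteq> 0"
      by (rule pfunE)
    with assms obtain u x v where u: "s = u @ x # v" "length u = i"
      by (metis split_at)
    with s(3) obtain x' where "x = Suc x'"
      by (cases x) (auto simp: nth_append)
    with s u have "y = (u @ Suc x' # v, u @ x' # v)" "length v = N - Suc i"
      by (auto simp: nth_append list_update_append)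
    with u show "y \<in> {(u @ Suc x # v, u @ x # v) | x u v. length u = i \<and> length v = N - Suc i}"
      by blast
  qed (use assms in \<open>auto simp: nth_append list_update_append\<close>)
qed (use assms in auto)

lemma pfun_test:
  assumes "i < N"
  shows "stack_definable N N (pfun N (\<lambda>s. s ! i = 0) (\<lambda>s. s))"
proof (rule stack_definable_cong[OF stack_test[of i "N - Suc i"]])
  show "{(u @ 0 # v, u @ 0 # v) | u v. length u = i \<and> length v = N - Suc i} =
    pfun N (\<lambda>s. s ! i = 0) (\<lambda>s. s)"
  proof (intro set_eqI iffI)
    fix y assume "y \<in> pfun N (\<lambda>s. s ! i = 0) (\<lambda>s. s)"
    then obtain s where s: "y = (s, s)" "length s = N" "s ! i = 0"
      by (rule pfunE)
    with assms obtain u x v where u: "s = u @ x # v" "length u = i"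
      by (metis split_at)
    with s have "y = (u @ 0 # v, u @ 0 # v)" "length v = N - Suc i"
      by (auto simp: nth_append list_update_append)
    with u show "y \<in> {(u @ 0 # v, u @ 0 # v) | u v. length u = i \<and> length v = N - Suc i}"
      by blast
  qed (use assms in \<open>auto simp: nth_append\<close>)
qed (use assms in auto)

lemma pfun_pop:
  assumes "i \<le> N"
  shows "stack_definable (Suc N) N (pfun (Suc N) (\<lambda>s. s ! i = 0) (\<lambda>s. take i s @ drop (Suc i) s))"
proof (rule stack_definable_cong[OF stack_pop[of i "N - i"]])
  show "{(u @ 0 # v, u @ v) | u v. length u = i \<and> length v = N - i} =
    pfun (Suc N) (\<lambda>s. s ! i = 0) (\<lambda>s. take i s @ drop (Suc i) s)"
  proof (intro set_eqI iffI)
    fix y assume "y \<in> pfun (Suc N) (\<lambda>s. s ! i = 0) (\<lambda>s. take i s @ drop (Suc i) s)"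
    then obtain s where s: "y = (s, take i s @ drop (Suc i) s)" "length s = Suc N" "s ! i = 0"
      by (rule pfunE)
    with assms obtain u x v where u: "s = u @ x # v" "length u = i"
      by (metis split_at le_imp_less_Suc)
    with s have "y = (u @ 0 # v, u @ v)" "length v = N - i"
      by (auto simp: nth_append list_update_append)
    with u show "y \<in> {(u @ 0 # v, u @ v) | u v. length u = i \<and> length v = N - i}"
      by blast
  qed (use assms in \<open>auto simp: nth_append\<close>)
qed (use assms in auto)

lemma pfun_push: "stack_definable N (Suc N) (pfun N (\<lambda>s. True) (\<lambda>s. 0 # s))"
  by (rule stack_definable_cong[OF stack_push]) auto

text \<open>Only a zero entry can be popped, so the entry is counted down first.\<close>

lemma pfun_remove:
  assumes "i \<le> N"
  shows "stack_definable (Suc N) N (pfun (Suc N) (\<lambda>s. True) (\<lambda>s. take i s @ drop (Suc i) s))"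
proof (rule stack_definable_pfun_cong)
  show "stack_definable (Suc N) N (pfun (Suc N) (\<lambda>s. True)
      (\<lambda>s. (\<lambda>s. take i s @ drop (Suc i) s) (((\<lambda>s. s[i := s ! i - 1]) ^^ (s ! i)) s)))"
    by (rule stack_definable_loop[OF pfun_dec pfun_pop]) (use assms in simp_all)
  show "(\<lambda>s. take i s @ drop (Suc i) s) (((\<lambda>s. s[i := s ! i - 1]) ^^ (s ! i)) s) =
      take i s @ drop (Suc i) s" for s :: "nat list"
  proof -
    have "take i (((\<lambda>s. s[i := s ! i - 1]) ^^ n) s) = take i s"
      "drop (Suc i) (((\<lambda>s. s[i := s ! i - 1]) ^^ n) s) = drop (Suc i) s" for n
      by (induction n) auto
    then show ?thesis by simp
  qed
qed simp

text \<open>Reading an entry destroys it. It is therefore drained into two new counters on top of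
  the stack, and one of these is drained back and popped. The two counters explain the shift of the
  index by 2.\<close>

lemma pfun_copy:
  assumes "i < N"
  shows "stack_definable N (Suc N) (pfun N (\<lambda>s. True) (\<lambda>s. s ! i # s))"
proof -
  let ?f = "\<lambda>s. let s = s[i + 2 := s ! (i + 2) - 1]; s = s[0 := Suc (s ! 0)] in s[1 := Suc (s ! 1)]"
  let ?g = "\<lambda>s. let s = s[0 := s ! 0 - 1] in s[i + 2 := Suc (s ! (i + 2))]"
  let ?p = "\<lambda>s. take 0 s @ drop (Suc 0) s"
  have f: "(?f ^^ n) (t # k # w) = (t + n) # (k + n) # w[i := w ! i - n]" if "i < length w"
    for n t k and w :: "nat list"
  proof (induction n)
    case (Suc n)
    then show ?case using that by (simp add: Let_def)
  qed simp
  have g: "(?g ^^ n) (t # k # w) = (t - n) # k # w[i := w ! i + n]" if "i < length w"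
    for n t k and w :: "nat list"
  proof (induction n)
    case (Suc n)
    then show ?case using that by (simp add: Let_def)
  qed simp
  have "stack_definable (Suc (Suc N)) (Suc (Suc N)) (pfun (Suc (Suc N)) (\<lambda>s. s ! (i + 2) \<noteq> 0) ?f)"
    using assms
    by (intro stack_definable_pfun_cong[OF stack_definable_pfun_comp[OF pfun_dec[of "i + 2"]
        stack_definable_pfun_comp[OF pfun_inc[of 0] pfun_inc[of 1]]]]) (auto simp: Let_def)
  then have 1: "stack_definable (Suc (Suc N)) (Suc (Suc N)) (pfun (Suc (Suc N)) (\<lambda>s. True)
      (\<lambda>s. (?f ^^ (s ! (i + 2))) s))"
    by (rule stack_definable_loop) (use assms in \<open>auto simp: Let_def intro!: pfun_test\<close>)
  have "stack_definable (Suc (Suc N)) (Suc (Suc N)) (pfun (Suc (Suc N)) (\<lambda>s. s ! 0 \<noteq> 0) ?g)"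
    using assms
    by (intro stack_definable_pfun_cong[OF stack_definable_pfun_comp[OF pfun_dec[of 0] pfun_inc[of "i + 2"]]])
      (auto simp: Let_def)
  then have 2: "stack_definable (Suc (Suc N)) (Suc N) (pfun (Suc (Suc N)) (\<lambda>s. True)
      (\<lambda>s. ?p ((?g ^^ (s ! 0)) s)))"
    by (rule stack_definable_loop) (use assms pfun_pop[of 0 "Suc N"] in \<open>auto simp: Let_def\<close>)
  show ?thesis
  proof (rule stack_definable_pfun_cong)
    show "stack_definable N (Suc N) (pfun N (\<lambda>s. ((True \<and> True) \<and> True) \<and> True)
      (\<lambda>s. (\<lambda>s. ?p ((?g ^^ (s ! 0)) s)) ((\<lambda>s. (?f ^^ (s ! (i + 2))) s) (0 # 0 # s))))"
      by (rule stack_definable_pfun_comp[OF stack_definable_pfun_comp[OF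
          stack_definable_pfun_comp[OF pfun_push pfun_push] 1] 2])
    show "(\<lambda>s. ?p ((?g ^^ (s ! 0)) s)) ((\<lambda>s. (?f ^^ (s ! (i + 2))) s) (0 # 0 # s)) = s ! i # s"
      if "length s = N" for s
      using f[of s "s ! i" 0 0] g[of "s[i := 0]" "s ! i" "s ! i" "s ! i"] that assms
      by (simp add: Let_def)
  qed simp
qed

section \<open>Compilation of recursive functions\<close>

text \<open>Divergence of \<open>f\<close> shows as the absence of a successor stack, so partiality
  is carried by the relation itself.\<close>

definition call_rel :: "recf \<Rightarrow> nat \<Rightarrow> nat list \<Rightarrow> nat list rel" where
  "call_rel f N idxs = {(s, s'). length s = N \<and> (\<exists>z. s' = z # s \<and> eval f (map ((!) s) idxs) z)}"

lemma call_rel_iff [simp]: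
  "(s, s') \<in> call_rel f N idxs \<longleftrightarrow> length s = N \<and> (\<exists>z. s' = z # s \<and> eval f (map ((!) s) idxs) z)"
  by (simp add: call_rel_def)

text \<open>All larger \<open>N\<close> are included because a call takes place on top of data that
  the caller keeps.\<close>

definition compilable :: "recf \<Rightarrow> nat \<Rightarrow> bool" where
  "compilable f n \<longleftrightarrow> (\<forall>N\<ge>n. stack_definable N (Suc N) (call_rel f N [0..<n]))"

lemma map_nth_block:
  assumes "length u = k" "n \<le> length s" "m = k + n"
  shows "map ((!) (u @ s)) [k..<m] = take n s"
  using assms by (intro nth_equalityI) (auto simp: nth_append)

lemma pfun_id: "stack_definable N N (pfun N (\<lambda>s. True) (\<lambda>s. s))"
  by (rule stack_definable_cong[OF stack_id]) auto

text \<open>Copies are pushed from the last index to the first; the copies already present shift the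
  original entries, whence the offset \<open>length idxs\<close>.\<close>

lemma pfun_copies:
  assumes "set idxs \<subseteq> {..<N}"
  shows "stack_definable N (length idxs + N) (pfun N (\<lambda>s. True) (\<lambda>s. map ((!) s) idxs @ s))"
  using assms
proof (induction idxs)
  case Nil
  then show ?case using pfun_id by simp
next
  case (Cons i idxs)
  have "stack_definable (length idxs + N) (Suc (length idxs + N)) (pfun (length idxs + N) (\<lambda>s. True)
      (\<lambda>s. s ! (length idxs + i) # s))"
    using Cons.prems by (intro pfun_copy) simp
  moreover have "stack_definable N (length idxs + N) (pfun N (\<lambda>s. True) (\<lambda>s. map ((!) s) idxs @ s))"
    using Cons by simp
  ultimately have "stack_definable N (Suc (length idxs + N)) (pfun N (\<lambda>s. True \<and> True)
      (\<lambda>s. (map ((!) s) idxs @ s) ! (length idxs + i) # map ((!) s) idxs @ s))"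
    by (rule stack_definable_pfun_comp[rotated])
  then show ?case
    by (rule stack_definable_cong) (auto simp: nth_append)
qed

lemma pfun_removes:
  "stack_definable (Suc (k + N)) (Suc N) (pfun (Suc (k + N)) (\<lambda>s. True)
     (\<lambda>s. take 1 s @ drop (Suc k) s))"
proof (induction k)
  case 0
  then show ?case
    by (rule stack_definable_pfun_cong[OF stack_definable_cong[OF pfun_id[of "Suc N"]]])
      (auto simp: append_take_drop_id)
next
  case (Suc k)
  have "stack_definable (Suc (Suc k + N)) (Suc (k + N)) (pfun (Suc (Suc k + N)) (\<lambda>s. True)
      (\<lambda>s. take 1 s @ drop (Suc 1) s))"
    using pfun_remove[of 1 "Suc k + N"] by simp
  from stack_definable_pfun_comp[OF this Suc.IH] show ?case
    by (rule stack_definable_pfun_cong) (auto simp: drop_Suc)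
qed

text \<open>Calling convention: the arguments are copied to the top from anywhere in the stack,
  \<open>f\<close> runs on the copies, and the copies below the result are deleted.\<close>

lemma stack_call:
  assumes "compilable f (length idxs)" "set idxs \<subseteq> {..<N}"
  shows "stack_definable N (Suc N) (call_rel f N idxs)"
proof -
  let ?A = "pfun N (\<lambda>s. True) (\<lambda>s. map ((!) s) idxs @ s)"
  let ?B = "call_rel f (length idxs + N) [0..<length idxs]"
  let ?C = "pfun (Suc (length idxs + N)) (\<lambda>s. True) (\<lambda>s. take 1 s @ drop (Suc (length idxs)) s)"
  have "stack_definable N (Suc N) (?A O ?B O ?C)"
    using assms
    by (intro stack_definable_comp[OF pfun_copies] stack_definable_comp[OF _ pfun_removes])
      (auto simp: compilable_def)
  moreover have "?A O ?B O ?C = call_rel f N idxs"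
  proof (intro equalityI subrelI)
    have args: "map ((!) (map ((!) s) idxs @ s)) [0..<length idxs] = map ((!) s) idxs" for s :: "nat list"
      by (intro nth_equalityI) (auto simp: nth_append)
    show "(s, s') \<in> call_rel f N idxs" if A: "(s, s') \<in> ?A O ?B O ?C" for s s'
    proof -
      from A obtain z where "length s = N" "s' = z # s"
        "eval f (map ((!) (map ((!) s) idxs @ s)) [0..<length idxs]) z"
        by auto
      then show ?thesis
        by (simp only: args call_rel_iff) blast
    qed
    show "(s, s') \<in> ?A O ?B O ?C" if A: "(s, s') \<in> call_rel f N idxs" for s s'
    proof -
      from A obtain z where z: "length s = N" "s' = z # s" "eval f (map ((!) s) idxs) z"
        by auto
      let ?t = "map ((!) s) idxs @ s"
      have "(s, ?t) \<in> ?A" "(z # ?t, s') \<in> ?C"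
        using z by simp_all
      moreover have "(?t, z # ?t) \<in> ?B"
        unfolding call_rel_iff args using z by simp
      ultimately show ?thesis
        by blast
    qed
  qed
  ultimately show ?thesis
    by simp
qed

section \<open>Compilation of the constructors of \<open>recf\<close>\<close>

lemma compilable_Zero: "compilable Zero n"
  unfolding compilable_def
proof (intro allI impI)
  fix N
  show "stack_definable N (Suc N) (call_rel Zero N [0..<n])"
    by (rule stack_definable_cong[OF pfun_push]) (auto intro: eval_Zero elim: eval.cases)
qed

inductive_cases eval_ZeroE: "eval Zero xs z"
inductive_cases eval_SuccE: "eval Succ xs z"
inductive_cases eval_ProjE: "eval (Proj i) xs z"
inductive_cases eval_CompE: "eval (Comp f gs) xs z"
inductive_cases eval_Prim0E: "eval (Prim f g) (0 # xs) z"
inductive_cases eval_PrimSE: "eval (Prim f g) (Suc n # xs) z"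
inductive_cases eval_PrimE: "eval (Prim f g) xs z"
inductive_cases eval_MuE: "eval (Mu f) xs z"

lemma eval_Succ_iff: "eval Succ xs z \<longleftrightarrow> (\<exists>x ys. xs = x # ys \<and> z = Suc x)"
  by (auto intro: eval_Succ elim: eval_SuccE)

lemma eval_Proj_iff: "eval (Proj i) xs z \<longleftrightarrow> i < length xs \<and> z = xs ! i"
  by (auto intro: eval_Proj elim: eval_ProjE)

lemma eval_Comp_iff:
  "eval (Comp f gs) xs z \<longleftrightarrow> (\<exists>ys. list_all2 (\<lambda>g y. eval g xs y) gs ys \<and> eval f ys z)"
  unfolding list_all2_conv_all_nth by (metis eval_Comp eval_CompE)

lemma eval_Mu_iff:
  "eval (Mu f) xs n \<longleftrightarrow> eval f (n # xs) 0 \<and> (\<forall>m<n. \<exists>y. eval f (m # xs) (Suc y))"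
  by (auto intro: eval_Mu elim!: eval_MuE)

lemma compilable_Succ: "compilable Succ n"
  unfolding compilable_def
proof (intro allI impI)
  fix N assume "n \<le> N"
  show "stack_definable N (Suc N) (call_rel Succ N [0..<n])"
  proof (cases n)
    case 0
    have "call_rel Succ N [0..<n] = {}"
      unfolding 0 by (auto simp: call_rel_def eval_Succ_iff)
    then show ?thesis
      by (simp add: stack_definable_empty)
  next
    case (Suc m)
    with \<open>n \<le> N\<close> have "stack_definable N (Suc N) (pfun N (\<lambda>s. True) (\<lambda>s. (s ! 0 # s)[0 := Suc ((s ! 0 # s) ! 0)]))"
      using stack_definable_pfun_comp[OF pfun_copy[of 0 N] pfun_inc[of 0 "Suc N"]] by simp
    then show ?thesis
      by (rule stack_definable_cong) (auto simp: Suc eval_Succ_iff upt_conv_Cons simp del: upt_Suc)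
  qed
qed

lemma compilable_Proj: "compilable (Proj i) n"
  unfolding compilable_def
proof (intro allI impI)
  fix N assume "n \<le> N"
  show "stack_definable N (Suc N) (call_rel (Proj i) N [0..<n])"
  proof (cases "i < n")
    case False
    then have "call_rel (Proj i) N [0..<n] = {}"
      by (auto simp: call_rel_def eval_Proj_iff)
    then show ?thesis
      by (simp add: stack_definable_empty)
  next
    case True
    with \<open>n \<le> N\<close> show ?thesis
      by (intro stack_definable_cong[OF pfun_copy[of i N]]) (auto simp: eval_Proj_iff)
  qed
qed

text \<open>The functions are called from the last to the first, so that their results end up on the
  stack in the order of \<open>gs\<close>. Meanwhile the common arguments have sunk by the number of
  results so far.\<close>

lemma stack_calls:
  assumes "\<forall>g\<in>set gs. compilable g n" "n \<le> N"
  shows "stack_definable N (length gs + N) {(s, s'). length s = N \<and>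
    (\<exists>ys. s' = ys @ s \<and> list_all2 (\<lambda>g y. eval g (take n s) y) gs ys)}"
  using assms(1)
proof (induction gs)
  case Nil
  show ?case
    by (rule stack_definable_cong[OF pfun_id]) auto
next
  case (Cons g gs)
  have "stack_definable (length gs + N) (Suc (length gs + N))
      (call_rel g (length gs + N) [length gs..<length gs + n])"
    using Cons.prems assms(2) by (intro stack_call) auto
  from stack_definable_comp[OF Cons.IH this] Cons.prems show ?case
  proof (rule_tac stack_definable_cong)
    show "{(s, s'). length s = N \<and> (\<exists>ys. s' = ys @ s \<and> list_all2 (\<lambda>g y. eval g (take n s) y) gs ys)} O
      call_rel g (length gs + N) [length gs..<length gs + n] =
      {(s, s'). length s = N \<and> (\<exists>ys. s' = ys @ s \<and> list_all2 (\<lambda>g y. eval g (take n s) y) (g # gs) ys)}"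
      (is "?A O ?B = ?C")
    proof (intro equalityI subrelI)
      fix s s' assume "(s, s') \<in> ?A O ?B"
      then obtain ys z where "length s = N" "list_all2 (\<lambda>g y. eval g (take n s) y) gs ys"
        "s' = z # ys @ s" "eval g (map ((!) (ys @ s)) [length gs..<length gs + n]) z"
        by auto
      then show "(s, s') \<in> ?C"
        using map_nth_block[of ys "length gs" n s] assms(2)
        by (auto simp: list_all2_Cons1 dest: list_all2_lengthD)
    next
      fix s s' assume "(s, s') \<in> ?C"
      then obtain ys z where 1: "length s = N" "list_all2 (\<lambda>g y. eval g (take n s) y) gs ys"
        "s' = z # ys @ s" "eval g (take n s) z"
        by (auto simp: list_all2_Cons1)
      then have "(s, ys @ s) \<in> ?A" "(ys @ s, s') \<in> ?B"
        using map_nth_block[of ys "length gs" n s] assms(2)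
        by (auto dest: list_all2_lengthD)
      then show "(s, s') \<in> ?A O ?B"
        by (rule relcompI)
    qed
  qed simp_all
qed

lemma compilable_Comp:
  assumes "\<forall>n. compilable f n" "\<forall>g\<in>set gs. compilable g n"
  shows "compilable (Comp f gs) n"
  unfolding compilable_def
proof (intro allI impI)
  fix N assume "n \<le> N"
  let ?m = "length gs"
  let ?A = "{(s, s'). length s = N \<and> (\<exists>ys. s' = ys @ s \<and> list_all2 (\<lambda>g y. eval g (take n s) y) gs ys)}"
  let ?B = "call_rel f (?m + N) [0..<?m]"
  let ?C = "pfun (Suc (?m + N)) (\<lambda>s. True) (\<lambda>s. take 1 s @ drop (Suc ?m) s)"
  have "stack_definable N (Suc N) (?A O ?B O ?C)"
    using assms \<open>n \<le> N\<close>
    by (intro stack_definable_comp[OF stack_calls] stack_definable_comp[OF _ pfun_removes])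
      (auto simp: compilable_def)
  moreover have "?A O ?B O ?C = call_rel (Comp f gs) N [0..<n]"
  proof (intro equalityI subrelI)
    fix s s' assume "(s, s') \<in> ?A O ?B O ?C"
    then obtain ys z where 1: "length s = N" "list_all2 (\<lambda>g y. eval g (take n s) y) gs ys"
      "s' = z # s" "eval f (map ((!) (ys @ s)) [0..<?m]) z"
      by (auto dest: list_all2_lengthD)
    then have "eval f ys z"
      using map_nth_block[of "[]" 0 ?m "ys @ s"] by (auto dest: list_all2_lengthD)
    with 1 show "(s, s') \<in> call_rel (Comp f gs) N [0..<n]"
      using map_nth_block[of "[]" 0 n s] \<open>n \<le> N\<close> by (auto simp: eval_Comp_iff)
  next
    fix s s' assume "(s, s') \<in> call_rel (Comp f gs) N [0..<n]"
    then obtain ys z where 1: "length s = N" "list_all2 (\<lambda>g y. eval g (take n s) y) gs ys"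
      "s' = z # s" "eval f ys z"
      using map_nth_block[of "[]" 0 n s] \<open>n \<le> N\<close> by (auto simp: eval_Comp_iff)
    then have "length ys = ?m"
      by (auto dest: list_all2_lengthD)
    with 1 have "(s, ys @ s) \<in> ?A" "(ys @ s, z # ys @ s) \<in> ?B" "(z # ys @ s, s') \<in> ?C"
      using map_nth_block[of "[]" 0 ?m "ys @ s"] by auto
    then show "(s, s') \<in> ?A O ?B O ?C"
      by (intro relcompI)
  qed
  ultimately show "stack_definable N (Suc N) (call_rel (Comp f gs) N [0..<n])"
    by simp
qed

lemma take_eq_map_nth: "n \<le> length s \<Longrightarrow> map ((!) s) [0..<n] = take n s"
  using map_nth_block[of "[]" 0 n s] by simp

text \<open>The candidate \<open>m\<close> lies on top of \<open>s\<close>. The body needs a nonzero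
  value of \<open>f\<close> and goes on to \<open>Suc m\<close>; the continuation needs the value
  zero. If \<open>f\<close> diverges on a candidate, neither applies, in accordance with the demand
  of \<open>eval_Mu\<close> that all earlier values exist.\<close>

lemma compilable_Mu:
  assumes "\<forall>n. compilable f n"
  shows "compilable (Mu f) n"
  unfolding compilable_def
proof (intro allI impI)
  fix N assume n: "n \<le> N"
  let ?C = "call_rel f (Suc N) [0..<Suc n]"
  let ?P = "pfun (Suc (Suc N)) (\<lambda>t. t ! 0 \<noteq> 0) (\<lambda>t. Suc (t ! 1) # drop 2 t)"
  let ?Z = "pfun (Suc (Suc N)) (\<lambda>t. t ! 0 = 0) (\<lambda>t. take 0 t @ drop (Suc 0) t)"
  let ?I = "pfun N (\<lambda>s. True) (\<lambda>s. 0 # s)"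
  have C: "stack_definable (Suc N) (Suc (Suc N)) ?C"
    using n assms by (intro stack_call) auto
  \<comment> \<open>The decrement serves as a test that the value is nonzero; the value is then
    discarded.\<close>
  have P: "stack_definable (Suc (Suc N)) (Suc N) ?P"
    by (rule stack_definable_pfun_cong[OF stack_definable_pfun_comp[OF pfun_dec[of 0]
          stack_definable_pfun_comp[OF pfun_remove[of 0] pfun_inc[of 0]]]])
      (auto simp: length_Suc_conv)
  have Z: "stack_definable (Suc (Suc N)) (Suc N) ?Z"
    by (rule pfun_pop) simp
  have B_iff: "(t, t') \<in> ?C O ?P \<longleftrightarrow>
      (\<exists>m s y. t = m # s \<and> t' = Suc m # s \<and> length s = N \<and> eval f (m # take n s) (Suc y))" for t t'
  proof
    assume "(t, t') \<in> ?C O ?P"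
    then obtain z where "length t = Suc N" "z \<noteq> 0" "eval f (map ((!) t) [0..<Suc n]) z"
      "t' = Suc (t ! 0) # drop 1 t"
      by (auto simp del: upt_Suc)
    then show "\<exists>m s y. t = m # s \<and> t' = Suc m # s \<and> length s = N \<and> eval f (m # take n s) (Suc y)"
      using n by (cases t; cases z) (auto simp: take_eq_map_nth simp del: upt_Suc)
  next
    assume "\<exists>m s y. t = m # s \<and> t' = Suc m # s \<and> length s = N \<and> eval f (m # take n s) (Suc y)"
    then obtain m s y where "t = m # s" "t' = Suc m # s" "length s = N" "eval f (m # take n s) (Suc y)"
      by blast
    then have "(t, Suc y # t) \<in> ?C" "(Suc y # t, t') \<in> ?P"
      using n by (auto simp: take_eq_map_nth simp del: upt_Suc)
    then show "(t, t') \<in> ?C O ?P" ..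
  qed
  have E_iff: "(t, t') \<in> ?C O ?Z \<longleftrightarrow> t = t' \<and> length t = Suc N \<and> eval f (take (Suc n) t) 0" for t t'
  proof
    assume "(t, t') \<in> ?C O ?Z"
    then show "t = t' \<and> length t = Suc N \<and> eval f (take (Suc n) t) 0"
      using n by (auto simp: take_eq_map_nth simp del: upt_Suc)
  next
    assume "t = t' \<and> length t = Suc N \<and> eval f (take (Suc n) t) 0"
    then have "(t, 0 # t) \<in> ?C" "(0 # t, t') \<in> ?Z"
      using n by (auto simp: take_eq_map_nth simp del: upt_Suc)
    then show "(t, t') \<in> ?C O ?Z" ..
  qed
  define B where "B = ?C O ?P"
  define E where "E = ?C O ?Z"
  have B: "(t, t') \<in> B \<longleftrightarrow>
      (\<exists>m s y. t = m # s \<and> t' = Suc m # s \<and> length s = N \<and> eval f (m # take n s) (Suc y))" for t t'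
    unfolding B_def by (rule B_iff)
  have E: "(t, t') \<in> E \<longleftrightarrow> t = t' \<and> length t = Suc N \<and> eval f (take (Suc n) t) 0" for t t'
    unfolding E_def by (rule E_iff)
  have star1: "\<exists>m. t = m # s \<and> (\<forall>k<m. \<exists>y. eval f (k # take n s) (Suc y))"
    if "(0 # s, t) \<in> B\<^sup>*" for s t
    using that
  proof (induction rule: rtrancl_induct)
    case (step t t')
    then show ?case
      unfolding B by (auto simp: less_Suc_eq)
  qed simp
  have star2: "(0 # s, m # s) \<in> B\<^sup>*"
    if "\<forall>k<m. \<exists>y. eval f (k # take n s) (Suc y)" "length s = N" for s m
    using that
  proof (induction m)
    case (Suc m)
    then have "(m # s, Suc m # s) \<in> B"
      unfolding B by auto
    with Suc show ?case
      by (simp add: rtrancl_into_rtrancl)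
  qed simp
  have "stack_definable N (Suc N) (?I O B\<^sup>* O E)"
    unfolding B_def E_def
    by (intro stack_definable_comp[OF pfun_push] stack_definable_star
        stack_definable_comp[OF C P] stack_definable_comp[OF C Z])
  moreover have "?I O B\<^sup>* O E = call_rel (Mu f) N [0..<n]"
  proof (intro equalityI subrelI)
    fix s s' assume "(s, s') \<in> ?I O B\<^sup>* O E"
    then obtain t where "length s = N" "(0 # s, t) \<in> B\<^sup>*" "(t, s') \<in> E"
      by auto
    then have "length s = N" "(0 # s, s') \<in> B\<^sup>*" "eval f (take (Suc n) s') 0"
      unfolding E by auto
    with star1[of s s'] show "(s, s') \<in> call_rel (Mu f) N [0..<n]"
      using n by (auto simp: eval_Mu_iff take_eq_map_nth)
  next
    fix s s' assume "(s, s') \<in> call_rel (Mu f) N [0..<n]"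
    then obtain m where m: "s' = m # s" "length s = N" "eval f (m # take n s) 0"
      "\<forall>k<m. \<exists>y. eval f (k # take n s) (Suc y)"
      using n by (auto simp: eval_Mu_iff take_eq_map_nth)
    have "(s, 0 # s) \<in> ?I" "(s', s') \<in> E"
      unfolding E using m by simp_all
    with star2[of m s] m show "(s, s') \<in> ?I O B\<^sup>* O E"
      by blast
  qed
  ultimately show "stack_definable N (Suc N) (call_rel (Mu f) N [0..<n])"
    by simp
qed

text \<open>The loop works on \<open>y # i # r # s\<close>, where \<open>y\<close> is the value at
  \<open>i\<close> and \<open>i + r\<close> stays equal to the recursion argument
  \<open>s ! 0\<close>. Two counters are kept because \<open>g\<close> wants the index counted
  upwards, whereas the loop can only compare a counter with zero.\<close>

lemma compilable_Prim:
  assumes f: "\<forall>n. compilable f n" and g: "\<forall>n. compilable g n"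
  shows "compilable (Prim f g) n"
  unfolding compilable_def
proof (intro allI impI)
  fix N assume nN: "n \<le> N"
  show "stack_definable N (Suc N) (call_rel (Prim f g) N [0..<n])"
  proof (cases n)
    case 0
    have "call_rel (Prim f g) N [0..<n] = {}"
      unfolding 0 by (auto simp: call_rel_def elim: eval_PrimE)
    then show ?thesis
      by (simp add: stack_definable_empty)
  next
    case (Suc k)
    let ?xs = "\<lambda>s. take k (tl s)"
    let ?I = "pfun N (\<lambda>s. True) (\<lambda>s. 0 # s ! 0 # s)"
    let ?F = "call_rel f (Suc (Suc N)) [3..<3 + k]"
    let ?D = "pfun (Suc (Suc (Suc N))) (\<lambda>t. t ! 2 \<noteq> 0) (\<lambda>t. t[2 := t ! 2 - 1])"
    \<comment> \<open>Positions in \<open>y # i # r # s\<close>: first \<open>i\<close>, then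
      \<open>y\<close>, then the parameters, which start at 4 because the recursion argument
      \<open>s ! 0\<close> sits at 3.\<close>
    let ?G = "call_rel g (Suc (Suc (Suc N))) (1 # 0 # [4..<4 + k])"
    let ?P = "pfun (Suc (Suc (Suc (Suc N)))) (\<lambda>t. True) (\<lambda>t. t ! 0 # Suc (t ! 2) # drop 3 t)"
    let ?Z = "pfun (Suc (Suc (Suc N))) (\<lambda>t. t ! 2 = 0) (\<lambda>t. take 1 t @ drop 3 t)"
    have I: "stack_definable N (Suc (Suc N)) ?I"
      using stack_definable_pfun_comp[OF pfun_copy[of 0 N] pfun_push] nN Suc by simp
    have F: "stack_definable (Suc (Suc N)) (Suc (Suc (Suc N))) ?F"
      using nN Suc f by (intro stack_call) auto
    have D: "stack_definable (Suc (Suc (Suc N))) (Suc (Suc (Suc N))) ?D"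
      using nN Suc by (intro pfun_dec) simp
    have G: "stack_definable (Suc (Suc (Suc N))) (Suc (Suc (Suc (Suc N)))) ?G"
      using nN Suc g by (intro stack_call) auto
    have P: "stack_definable (Suc (Suc (Suc (Suc N)))) (Suc (Suc (Suc N))) ?P"
      by (rule stack_definable_pfun_cong[OF
            stack_definable_pfun_comp[OF pfun_remove[of 1] pfun_inc[of 1]]])
        (auto simp: length_Suc_conv)
    have Z: "stack_definable (Suc (Suc (Suc N))) (Suc N) ?Z"
      by (rule stack_definable_pfun_cong[OF stack_definable_pfun_comp[OF pfun_test[of 2]
            stack_definable_pfun_comp[OF pfun_remove[of 1] pfun_remove[of 1]]]])
        (use nN Suc in \<open>auto simp: length_Suc_conv\<close>)
    define B where "B = ?D O ?G O ?P"
    have args_f: "map ((!) (0 # c # s)) [3..<3 + k] = ?xs s" if "length s = N" for c s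
      using that nN Suc map_nth_block[of "[0, c, hd s]" 3 k "tl s"] by (cases s) auto
    have args_g: "map ((!) (y # i # r # s)) (1 # 0 # [4..<4 + k]) = i # y # ?xs s"
      if "length s = N" for y i r s
      using that nN Suc map_nth_block[of "[y, i, r, hd s]" 4 k "tl s"] by (cases s) auto
    have args_Prim: "map ((!) s) [0..<n] = s ! 0 # ?xs s" if "length s = N" for s
      using that nN Suc by (cases s) (auto simp: take_eq_map_nth simp del: upt_Suc)
    have B_iff: "(t, t') \<in> (?D O ?G O ?P) \<longleftrightarrow> (\<exists>y i r s z. t = y # i # Suc r # s \<and> t' = z # Suc i # r # s \<and>
        length s = N \<and> eval g (i # y # ?xs s) z)" for t t'
    proof
      assume "(t, t') \<in> (?D O ?G O ?P)"
      then obtain z where 1: "length t = Suc (Suc (Suc N))" "t ! 2 \<noteq> 0"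
        "eval g (map ((!) (t[2 := t ! 2 - 1])) (1 # 0 # [4..<4 + k])) z"
        "t' = z # Suc (t[2 := t ! 2 - 1] ! 1) # drop 2 (t[2 := t ! 2 - 1])"
        by (auto simp del: list.map)
      then obtain y i r s where t: "t = y # i # Suc r # s" "length s = N"
        by (auto simp: length_Suc_conv gr0_conv_Suc)
      with 1(3) have "eval g (i # y # ?xs s) z"
        using args_g[of s y i r] by simp
      with 1(4) t show "\<exists>y i r s z. t = y # i # Suc r # s \<and> t' = z # Suc i # r # s \<and>
        length s = N \<and> eval g (i # y # ?xs s) z"
        by auto
    next
      assume "\<exists>y i r s z. t = y # i # Suc r # s \<and> t' = z # Suc i # r # s \<and>
        length s = N \<and> eval g (i # y # ?xs s) z"
      then obtain y i r s z where 1: "t = y # i # Suc r # s" "t' = z # Suc i # r # s"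
        "length s = N" "eval g (i # y # ?xs s) z"
        by blast
      have "(t, y # i # r # s) \<in> ?D" "(z # y # i # r # s, t') \<in> ?P"
        using 1 by auto
      moreover have "(y # i # r # s, z # y # i # r # s) \<in> ?G"
        unfolding call_rel_iff args_g[OF 1(3)] using 1 by simp
      ultimately show "(t, t') \<in> (?D O ?G O ?P)"
        by blast
    qed
    have B: "(t, t') \<in> B \<longleftrightarrow> (\<exists>y i r s z. t = y # i # Suc r # s \<and> t' = z # Suc i # r # s \<and>
        length s = N \<and> eval g (i # y # ?xs s) z)" for t t'
      unfolding B_def by (rule B_iff)
    have star1: "\<exists>y i r. t = y # i # r # s \<and> i + r = c \<and> eval (Prim f g) (i # ?xs s) y"
      if "(y0 # 0 # c # s, t) \<in> B\<^sup>*" "eval f (?xs s) y0" for y0 c s t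
      using that(1)
    proof (induction rule: rtrancl_induct)
      case base
      then show ?case
        using that(2) by (auto intro: eval_Prim0)
    next
      case (step t t')
      then show ?case
        unfolding B by (auto intro: eval_PrimS)
    qed
    have star2: "\<exists>y0. eval f (?xs s) y0 \<and> (y0 # 0 # (i + r) # s, y # i # r # s) \<in> B\<^sup>*"
      if "eval (Prim f g) (i # ?xs s) y" "length s = N" for i r s y
      using that
    proof (induction i arbitrary: r y)
      case 0
      then show ?case
        by (auto elim: eval_Prim0E)
    next
      case (Suc i)
      then obtain z where z: "eval (Prim f g) (i # ?xs s) z" "eval g (i # z # ?xs s) y"
        by (auto elim: eval_PrimSE)
      then have "(z # i # Suc r # s, y # Suc i # r # s) \<in> B"
        unfolding B using Suc.prems by blast
      with Suc.IH[OF z(1) Suc.prems(2), of "Suc r"] show ?case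
        by (auto intro: rtrancl_into_rtrancl)
    qed
    have "stack_definable N (Suc N) (?I O ?F O B\<^sup>* O ?Z)"
      unfolding B_def
      by (intro stack_definable_comp[OF I] stack_definable_comp[OF F] stack_definable_star
          stack_definable_comp[OF D] stack_definable_comp[OF G] P Z)
    moreover have "?I O ?F O B\<^sup>* O ?Z = call_rel (Prim f g) N [0..<n]"
    proof (intro equalityI subrelI)
      fix s s' assume "(s, s') \<in> ?I O ?F O B\<^sup>* O ?Z"
      then obtain t y0 where 1: "length s = N" "eval f (map ((!) (0 # s ! 0 # s)) [3..<3 + k]) y0"
        "(y0 # 0 # s ! 0 # s, t) \<in> B\<^sup>*" "t ! 2 = 0" "s' = take 1 t @ drop 3 t"
        by auto
      have "eval f (?xs s) y0"
        using 1(2) unfolding args_f[OF 1(1)] .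
      from star1[OF 1(3) this] obtain y i r where "t = y # i # r # s" "i + r = s ! 0"
        "eval (Prim f g) (i # ?xs s) y"
        by blast
      moreover from this 1(4,5) have "r = 0" "s' = y # s"
        by auto
      ultimately show "(s, s') \<in> call_rel (Prim f g) N [0..<n]"
        using 1(1) by (simp add: args_Prim)
    next
      fix s s' assume "(s, s') \<in> call_rel (Prim f g) N [0..<n]"
      then obtain z where z: "length s = N" "s' = z # s" "eval (Prim f g) (s ! 0 # ?xs s) z"
        by (auto simp: args_Prim)
      from star2[OF z(3,1), of 0] obtain y0 where y0: "eval f (?xs s) y0"
        "(y0 # 0 # s ! 0 # s, z # s ! 0 # 0 # s) \<in> B\<^sup>*"
        by auto
      have "(s, 0 # s ! 0 # s) \<in> ?I" "(z # s ! 0 # 0 # s, s') \<in> ?Z"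
        using z by auto
      moreover have "(0 # s ! 0 # s, y0 # 0 # s ! 0 # s) \<in> ?F"
        unfolding call_rel_iff args_f[OF z(1)] using y0 z by simp
      ultimately show "(s, s') \<in> ?I O ?F O B\<^sup>* O ?Z"
        using y0(2) by blast
    qed
    ultimately show ?thesis
      by simp
  qed
qed

theorem compilable: "compilable f n"
proof (induction f arbitrary: n)
  case Zero
  show ?case by (rule compilable_Zero)
next
  case Succ
  show ?case by (rule compilable_Succ)
next
  case (Proj i)
  show ?case by (rule compilable_Proj)
next
  case (Comp f gs)
  then show ?case by (intro compilable_Comp) auto
next
  case (Prim f g)
  then show ?case by (intro compilable_Prim) auto
next
  case (Mu f)
  then show ?case by (intro compilable_Mu) auto
qed

text \<open>Serves to exclude every answer of a decision procedure other than the one it is known to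
  give.\<close>

lemma eval_deterministic: "eval f xs y \<Longrightarrow> eval f xs z \<Longrightarrow> y = z"
proof (induction arbitrary: z rule: eval.induct)
  case (eval_Comp ys gs xs f y)
  from eval_Comp.prems obtain zs where zs: "list_all2 (\<lambda>g y. eval g xs y) gs zs" "eval f zs z"
    by (auto simp: eval_Comp_iff)
  then have "zs = ys"
    using eval_Comp.hyps(1) eval_Comp.IH(1)
    by (intro nth_equalityI) (simp_all add: list_all2_conv_all_nth, metis)
  with zs eval_Comp.IH(2) show ?case
    by simp
next
  case (eval_Mu f n xs)
  then have z: "eval f (z # xs) 0" "\<forall>m<z. \<exists>y. eval f (m # xs) (Suc y)"
    by (auto simp: eval_Mu_iff)
  show ?case
  proof (rule linorder_cases[of n z])
    assume "n < z"
    with z(2) eval_Mu.IH(1) show ?thesis by blast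
  next
    assume "z < n"
    with z(1) eval_Mu.IH(2) show ?thesis by blast
  qed
next
  case (eval_Prim0 f xs y g)
  then show ?case by (blast elim: eval_Prim0E)
next
  case (eval_PrimS f g n xs y x)
  from eval_PrimS.prems obtain y' where "eval (Prim f g) (n # xs) y'" "eval g (n # y' # xs) z"
    by (rule eval_PrimSE)
  with eval_PrimS.IH show ?case by blast
qed (auto elim: eval_ZeroE simp: eval_Succ_iff eval_Proj_iff)

text \<open>The exit of the compiled program is the accepting state 1. The quantification over
  \<open>T'\<close> leaves room to add the transitions that feed the input, the sink and the signal
  later.\<close>

theorem recf_automaton:
  obtains T p where "finite T" "p \<in> work_states" "fst ` T \<subseteq> work_states"
    "(snd \<circ> snd) ` T \<subseteq> insert 1 work_states"
    "\<And>T' n. agree work_states T T' \<Longrightarrow>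
       (\<exists>w m. acc T' m p (w, enc_stack [n] @ w)) \<longleftrightarrow> (\<exists>z. eval f [n] z)"
proof -
  have "stack_definable 1 2 (call_rel f 1 [0..<1])"
    using compilable[of f 1] by (simp add: compilable_def numeral_2_eq_2)
  then obtain D where D: "definable D" "stack_rel 1 (call_rel f 1 [0..<1]) D"
    by (rule stack_definableE)
  from D(1) finite.emptyI obtain T V p where T: "finite T" "V \<subseteq> work_states" "p \<in> V" "fst ` T \<subseteq> V"
    "(snd \<circ> snd) ` T \<subseteq> insert 1 V" "\<And>T'. agree V T T' \<Longrightarrow> simulates T' p 1 D"
    by (rule definableE[where q = 1]) blast
  have *: "(\<exists>w m. acc T' m p (w, enc_stack [n] @ w)) \<longleftrightarrow> (\<exists>z. eval f [n] z)"
    if "agree work_states T T'" for T' n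
  proof
    from that T(2) have sim: "simulates T' p 1 D"
      by (intro T(6)) (auto simp: agree_def)
    show "\<exists>z. eval f [n] z" if acc: "\<exists>w m. acc T' m p (w, enc_stack [n] @ w)"
    proof -
      from acc sim obtain w c' where "((w, enc_stack [n] @ w), c') \<in> D"
        unfolding simulates_def by blast
      with stack_relD1[OF D(2), of "[n]" w "fst c'" "snd c'"] show ?thesis
        by auto
    qed
    show "\<exists>w m. acc T' m p (w, enc_stack [n] @ w)" if ev: "\<exists>z. eval f [n] z"
    proof -
      from ev obtain z where "([n], [z, n]) \<in> call_rel f 1 [0..<1]"
        by auto
      \<comment> \<open>The word may end where the leading head stands when the computation
        halts.\<close>
      from stack_relD2[OF D(2) this, of "[]"] obtain w where
        "((w, enc_stack [n] @ w), ([], enc_stack [z, n] @ [])) \<in> D"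
        by blast
      moreover have "acc T' 0 1 c" for c
        by simp
      ultimately show ?thesis
        using sim unfolding simulates_def by blast
    qed
  qed
  show thesis
  proof (rule that)
    show "(snd \<circ> snd) ` T \<subseteq> insert 1 work_states"
      using T(2,5) by (meson insert_mono subset_trans)
    show "fst ` T \<subseteq> work_states" "p \<in> work_states"
      using T(2-4) by auto
    show "(\<exists>w m. acc T' m p (w, enc_stack [n] @ w)) \<longleftrightarrow> (\<exists>z. eval f [n] z)"
      if "agree work_states T T'" for T' n
      using that by (rule *)
  qed (rule T(1))
qed

section \<open>Closure properties of recursive functions\<close>

definition recursive :: "nat \<Rightarrow> (nat list \<Rightarrow> nat) \<Rightarrow> bool" where
  "recursive n F \<longleftrightarrow> (\<exists>f. \<forall>xs. length xs = n \<longrightarrow> eval f xs (F xs))"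

lemma recursive_comp:
  assumes "recursive (length Gs) F" "\<forall>G\<in>set Gs. recursive n G"
  shows "recursive n (\<lambda>xs. F (map (\<lambda>G. G xs) Gs))"
proof -
  obtain f where f: "\<And>xs. length xs = length Gs \<Longrightarrow> eval f xs (F xs)"
    using assms(1) unfolding recursive_def by blast
  obtain g where g: "\<And>G xs. G \<in> set Gs \<Longrightarrow> length xs = n \<Longrightarrow> eval (g G) xs (G xs)"
    using assms(2) unfolding recursive_def by metis
  have "eval (Comp f (map g Gs)) xs (F (map (\<lambda>G. G xs) Gs))" if "length xs = n" for xs
    using that by (intro eval_Comp[where ys = "map (\<lambda>G. G xs) Gs"]) (auto intro: f g)
  then show ?thesis
    unfolding recursive_def by blast
qed

lemma recursive_comp1:
  assumes "recursive 1 F" "recursive n A"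
  shows "recursive n (\<lambda>xs. F [A xs])"
  using recursive_comp[of "[A]" F n] assms by simp

lemma recursive_comp2:
  assumes "recursive 2 F" "recursive n A" "recursive n B"
  shows "recursive n (\<lambda>xs. F [A xs, B xs])"
  using recursive_comp[of "[A, B]" F n] assms by (simp add: numeral_2_eq_2)

lemma recursive_nth: "i < n \<Longrightarrow> recursive n (\<lambda>xs. xs ! i)"
  unfolding recursive_def by (metis eval_Proj)

lemma recursive_Suc:
  assumes "recursive n A"
  shows "recursive n (\<lambda>xs. Suc (A xs))"
proof -
  have "recursive 1 (\<lambda>xs. Suc (xs ! 0))"
    unfolding recursive_def by (rule exI[of _ Succ]) (auto simp: length_Suc_conv intro: eval_Succ)
  from recursive_comp1[OF this assms] show ?thesis
    by simp
qed

lemma recursive_const: "recursive n (\<lambda>_. k)"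
proof (induction k)
  case 0
  show ?case
    unfolding recursive_def by (meson eval_Zero)
qed (rule recursive_Suc)

lemma recursive_prim:
  assumes "recursive n F" "recursive (Suc (Suc n)) G"
    and "\<And>xs. length xs = n \<Longrightarrow> H (0 # xs) = F xs"
    and "\<And>m xs. length xs = n \<Longrightarrow> H (Suc m # xs) = G (m # H (m # xs) # xs)"
  shows "recursive (Suc n) H"
proof -
  obtain f where f: "\<And>xs. length xs = n \<Longrightarrow> eval f xs (F xs)"
    using assms(1) unfolding recursive_def by blast
  obtain g where g: "\<And>xs. length xs = Suc (Suc n) \<Longrightarrow> eval g xs (G xs)"
    using assms(2) unfolding recursive_def by blast
  have "eval (Prim f g) (m # xs) (H (m # xs))" if "length xs = n" for m xs
  proof (induction m)
    case 0
    show ?case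
      using that f assms(3) by (auto intro: eval_Prim0)
  next
    case (Suc m)
    then show ?case
      using that g[of "m # H (m # xs) # xs"] assms(4) by (auto intro: eval_PrimS)
  qed
  then show ?thesis
    unfolding recursive_def by (intro exI[of _ "Prim f g"]) (auto simp: length_Suc_conv)
qed

lemma recursive_add:
  assumes "recursive n A" "recursive n B"
  shows "recursive n (\<lambda>xs. A xs + B xs)"
proof -
  have "recursive (Suc 1) (\<lambda>xs. xs ! 0 + xs ! 1)"
    by (rule recursive_prim[OF recursive_nth[of 0] recursive_Suc[OF recursive_nth[of 1]]]) auto
  then have "recursive 2 (\<lambda>xs. xs ! 0 + xs ! 1)"
    by (simp add: numeral_2_eq_2)
  from recursive_comp2[OF this assms] show ?thesis
    by simp
qed

text \<open>\<open>prod_encode\<close> is a triangular number plus a summand, so this and addition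
  cover all codes built by pairing.\<close>

lemma recursive_triangle:
  assumes "recursive n A"
  shows "recursive n (\<lambda>xs. triangle (A xs))"
proof -
  have "recursive (Suc 0) (\<lambda>xs. triangle (xs ! 0))"
    by (rule recursive_prim[OF recursive_const[of 0 0],
          where G = "\<lambda>xs. xs ! 1 + Suc (xs ! 0)"])
      (auto intro!: recursive_add recursive_Suc recursive_nth)
  then have "recursive 1 (\<lambda>xs. triangle (xs ! 0))"
    by simp
  from recursive_comp1[OF this assms] show ?thesis
    by simp
qed

lemma recursive_prod_encode:
  assumes "recursive n A" "recursive n B"
  shows "recursive n (\<lambda>xs. prod_encode (A xs, B xs))"
  unfolding prod_encode_def using assms by (simp add: recursive_add recursive_triangle)

text \<open>An unbounded search whose body ignores the search variable succeeds at 0 or never. It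
  turns the answer 1 of \<open>D\<close> into halting and the answer 0 into divergence.\<close>

lemma recursive_halting_iff:
  assumes "recursive 1 G" and "\<forall>x. valid x \<longrightarrow> eval D [enc x] (if P x then 1 else 0)"
  obtains d where "\<And>e x. valid x \<Longrightarrow> G [e] = enc x \<Longrightarrow> (\<exists>z. eval d [e] z) \<longleftrightarrow> P x"
proof -
  have "recursive (Suc 0) (\<lambda>xs. if xs ! 0 = 0 then 1 else 0)"
    by (rule recursive_prim[OF recursive_const[of 0 1] recursive_const[of _ 0]]) auto
  then obtain neg where neg: "\<And>m. eval neg [m] (if m = 0 then 1 else 0)"
    unfolding recursive_def by (metis length_Cons list.size(3) nth_Cons_0)
  obtain g where g: "\<And>e. eval g [e] (G [e])"
    using assms(1) unfolding recursive_def by (metis One_nat_def length_Cons list.size(3))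
  \<comment> \<open>\<open>Proj 1\<close> skips the search variable at position 0, and
    \<open>neg\<close> turns the answer 1 into the zero that \<open>Mu\<close> looks for.\<close>
  define d where "d = Mu (Comp neg [Comp D [Comp g [Proj 1]]])"
  have "(\<exists>z. eval d [e] z) \<longleftrightarrow> P x" if "valid x" "G [e] = enc x" for e x
  proof -
    have D: "eval D [enc x] y \<longleftrightarrow> y = (if P x then 1 else 0)" for y
      using assms(2) that(1) eval_deterministic by blast
    have neg': "eval neg [m] y \<longleftrightarrow> y = (if m = 0 then 1 else 0)" for m y
      using neg eval_deterministic by blast
    have g': "eval g [e] y \<longleftrightarrow> y = enc x" for y
      using g eval_deterministic that(2) by metis
    have "eval (Comp neg [Comp D [Comp g [Proj 1]]]) [m, e] y \<longleftrightarrow> y = (if P x then 0 else 1)" for m y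
      by (auto simp: eval_Comp_iff list_all2_Cons1 eval_Proj_iff D neg' g')
    then show ?thesis
      unfolding d_def by (auto simp: eval_Mu_iff)
  qed
  then show thesis
    by (rule that)
qed

section \<open>The ring system\<close>

definition letter_msg :: "letter \<Rightarrow> nat" where
  "letter_msg l = (if fst l then 0 else 2) + of_bool (snd l)"

text \<open>Peer 1 is the checker. Peer 2 sends the garbage 6 to it and afterwards starts each round with 7.
  In a round peer 3 sends a letter to the checker (0 or 1) and to peer 4 (4 or 5), which forwards it to
  the checker (2 or 3) and closes the round with 8. Message 9 signals acceptance.\<close>

definition ring_msgs :: "(nat \<times> nat \<times> nat) list" where
  "ring_msgs = [(0, 3, 1), (1, 3, 1), (2, 4, 1), (3, 4, 1), (4, 3, 4), (5, 3, 4),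
     (6, 2, 1), (7, 2, 3), (8, 4, 2), (9, 1, 2)]"

definition ring_peers :: "peer_aut list" where
  "ring_peers =
     [(0, [(0, (True, 6), 1), (1, (True, 7), 2), (2, (False, 8), 1)]),
      (0, [(0, (False, 7), 1), (1, (True, 0), 2), (1, (True, 1), 3), (2, (True, 4), 0), (3, (True, 5), 0)]),
      (0, [(0, (False, 4), 1), (0, (False, 5), 2), (1, (True, 2), 3), (2, (True, 3), 3), (3, (True, 8), 0)])]"

text \<open>A number \<^term>\<open>a\<close> that is not a message has the unspecified source and destination
  \<^term>\<open>the None :: nat \<times> nat\<close>. If these exceeded the number of peers, then \<^const>\<open>trans_of\<close> would look
  beyond the end of the list of peers, at an unspecified automaton. Idle peers rule this out.\<close>

definition junk :: "nat \<times> nat" where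
  "junk = the None"

definition padding :: nat where
  "padding = fst junk + snd junk"

definition ring_system :: "peer_aut \<Rightarrow> system" where
  "ring_system P = ((4 + padding, ring_msgs), P # ring_peers @ replicate padding (0, []))"

text \<open>The loops of the sink 3 guarantee that no letter sent in a synchronous run has to wait
  once the checker is there. The sink cannot be left, and no letter leads into it.\<close>

definition checker :: "nat \<Rightarrow> (nat \<times> action \<times> nat) list \<Rightarrow> bool" where
  "checker i T \<longleftrightarrow> i \<noteq> 1 \<and> i \<noteq> 3 \<and> (i, (False, 6), 3) \<in> set T \<and> (\<forall>m<4. (3, (False, m), 3) \<in> set T) \<and>
     (\<forall>p b m q. (p, (b, m), q) \<in> set T \<longrightarrow>
        b \<and> m = 9 \<and> p = 1 \<or> \<not> b \<and> m = 6 \<and> p = i \<and> q = 3 \<or> \<not> b \<and> m < 4 \<and> (p = 3 \<longleftrightarrow> q = 3))"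

text \<open>The loops of the sink read letters too, but they are no part of the simulated
  automaton.\<close>

definition letter_trans :: "(nat \<times> action \<times> nat) list \<Rightarrow> ltrans set" where
  "letter_trans T = {(p, l, q). p \<noteq> 3 \<and> (p, (False, letter_msg l), q) \<in> set T}"

lemma checker_send: "checker i T \<Longrightarrow> (p, (True, m), q) \<in> set T \<Longrightarrow> m = 9 \<and> p = 1"
  and checker_recv: "checker i T \<Longrightarrow> (p, (False, m), q) \<in> set T \<Longrightarrow>
    m = 6 \<and> p = i \<and> q = 3 \<or> m < 4 \<and> (p = 3 \<longleftrightarrow> q = 3)"
  unfolding checker_def by blast+

lemma src_dst_ring [simp]:
  "src (ring_system P) 0 = 3" "src (ring_system P) (Suc 0) = 3" "src (ring_system P) 2 = 4"
  "src (ring_system P) 3 = 4" "src (ring_system P) 4 = 3" "src (ring_system P) 5 = 3"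
  "src (ring_system P) 6 = 2" "src (ring_system P) 7 = 2" "src (ring_system P) 8 = 4"
  "src (ring_system P) 9 = 1"
  "dst (ring_system P) 0 = 1" "dst (ring_system P) (Suc 0) = 1" "dst (ring_system P) 2 = 1"
  "dst (ring_system P) 3 = 1" "dst (ring_system P) 4 = 4" "dst (ring_system P) 5 = 4"
  "dst (ring_system P) 6 = 1" "dst (ring_system P) 7 = 3" "dst (ring_system P) 8 = 2"
  "dst (ring_system P) 9 = 2"
  by (simp_all add: src_def dst_def msgs_def ring_system_def ring_msgs_def)

lemma less_10_cases:
  assumes "a < (10 :: nat)"
  obtains "a = 0" | "a = Suc 0" | "a = 2" | "a = 3" | "a = 4" | "a = 5" | "a = 6" | "a = 7" | "a = 8" | "a = 9"
proof -
  from assms have "a = 0 \<or> a = Suc 0 \<or> a = 2 \<or> a = 3 \<or> a = 4 \<or> a = 5 \<or> a = 6 \<or> a = 7 \<or> a = 8 \<or> a = 9"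
    by arith
  with that show thesis by blast
qed

lemma src_dst_bound: "src (ring_system P) a \<le> 4 + padding" "dst (ring_system P) a \<le> 4 + padding"
proof -
  have "src (ring_system P) a \<le> 4 + padding \<and> dst (ring_system P) a \<le> 4 + padding"
  proof (cases "a < 10")
    case True
    then show ?thesis by (rule less_10_cases) simp_all
  next
    case False
    then have "map_of ring_msgs a = None"
      by (auto simp: ring_msgs_def)
    then show ?thesis
      by (simp add: src_def dst_def msgs_def ring_system_def padding_def junk_def)
  qed
  then show "src (ring_system P) a \<le> 4 + padding" "dst (ring_system P) a \<le> 4 + padding"
    by auto
qed

text \<open>Index 0 is covered because a number that is no message has an unspecified source,
  possibly 0; truncated subtraction then refers it to the checker.\<close>

lemma trans_of_ring [simp]:
  "trans_of (ring_system P) 0 = set (snd P)"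
  "trans_of (ring_system P) (Suc 0) = set (snd P)"
  "trans_of (ring_system P) 2 = {(0, (True, 6), 1), (1, (True, 7), 2), (2, (False, 8), 1)}"
  "trans_of (ring_system P) 3 = {(0, (False, 7), 1), (1, (True, 0), 2), (1, (True, 1), 3), (2, (True, 4), 0), (3, (True, 5), 0)}"
  "trans_of (ring_system P) 4 = {(0, (False, 4), 1), (0, (False, 5), 2), (1, (True, 2), 3), (2, (True, 3), 3), (3, (True, 8), 0)}"
  by (auto simp: trans_of_def peers_def ring_system_def ring_peers_def)

lemma trans_of_padding:
  assumes "4 < i" "i \<le> 4 + padding"
  shows "trans_of (ring_system P) i = {}"
proof -
  have "(P # ring_peers @ replicate padding (0, [])) ! (i - 1) = (0, [])"
    using assms by (auto simp: nth_Cons' nth_append ring_peers_def)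
  then show ?thesis
    by (simp add: trans_of_def peers_def ring_system_def)
qed

lemma trans_of_msg:
  assumes "checker i T" "(p, (b, a), q) \<in> trans_of (ring_system (i, T)) j" "j \<le> 4 + padding"
  shows "a < 10"
proof -
  consider "j = 0" | "j = Suc 0" | "j = 2" | "j = 3" | "j = 4" | "4 < j"
    by arith
  then show ?thesis
  proof cases
    case 6
    then show ?thesis
      using assms trans_of_padding[of j] by simp
  qed (use assms in \<open>auto simp: checker_def\<close>, fastforce+)
qed

text \<open>In the case names \<open>c\<close>, \<open>g\<close>, \<open>x\<close>, \<open>y\<close>
  indicate the moving peer 1, 2, 3, 4. The case \<open>c9\<close> describes no successor, since it
  only occurs where sending 9 is to be refuted.\<close>

lemma ring_step_cases [consumes 2]:
  assumes T: "checker i T" and "step (ring_system (i, T)) (c # g # x # y # r, ch) act cfg"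
  obtains
    (g6) "act = (True, 6)" "g = 0" "cfg = (c # 1 # x # y # r, ch((2, 1) := ch (2, 1) @ [6]))"
  | (g7) "act = (True, 7)" "g = 1" "cfg = (c # 2 # x # y # r, ch((2, 3) := ch (2, 3) @ [7]))"
  | (g8) w where "act = (False, 8)" "g = 2" "ch (4, 2) = 8 # w" "cfg = (c # 1 # x # y # r, ch((4, 2) := w))"
  | (x7) w where "act = (False, 7)" "x = 0" "ch (2, 3) = 7 # w" "cfg = (c # g # 1 # y # r, ch((2, 3) := w))"
  | (x1) b where "act = (True, letter_msg (True, b))" "x = 1"
      "cfg = (c # g # (2 + of_bool b) # y # r, ch((3, 1) := ch (3, 1) @ [letter_msg (True, b)]))"
  | (x2) b where "act = (True, 4 + of_bool b)" "x = 2 + of_bool b"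
      "cfg = (c # g # 0 # y # r, ch((3, 4) := ch (3, 4) @ [4 + of_bool b]))"
  | (y0) b w where "act = (False, 4 + of_bool b)" "y = 0" "ch (3, 4) = (4 + of_bool b) # w"
      "cfg = (c # g # x # (1 + of_bool b) # r, ch((3, 4) := w))"
  | (y1) b where "act = (True, letter_msg (False, b))" "y = 1 + of_bool b"
      "cfg = (c # g # x # 3 # r, ch((4, 1) := ch (4, 1) @ [letter_msg (False, b)]))"
  | (y3) "act = (True, 8)" "y = 3" "cfg = (c # g # x # 0 # r, ch((4, 2) := ch (4, 2) @ [8]))"
  | (c6) w where "act = (False, 6)" "c = i" "ch (2, 1) = 6 # w" "cfg = (3 # g # x # y # r, ch((2, 1) := w))"
  | (cl) l q w where "act = (False, letter_msg l)" "(c, (False, letter_msg l), q) \<in> set T" "c = 3 \<longleftrightarrow> q = 3"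
      "ch (if fst l then 3 else 4, 1) = letter_msg l # w"
      "cfg = (q # g # x # y # r, ch((if fst l then 3 else 4, 1) := w))"
  | (c9) "act = (True, 9)" "c = 1"
  using assms(2)
proof (cases rule: step.cases)
  case (step_send j a k q)
  have "a < 10"
    using trans_of_msg[OF T step_send(5)] src_dst_bound(1) step_send(3) by blast
  then show thesis
  proof (rule less_10_cases)
    assume "a = 0"
    with step_send show thesis by (intro x1[of False]) (auto simp: letter_msg_def)
  next
    assume "a = Suc 0"
    with step_send show thesis by (intro x1[of True]) (auto simp: letter_msg_def)
  next
    assume "a = 2"
    with step_send show thesis by (intro y1[of False]) (auto simp: letter_msg_def)
  next
    assume "a = 3"
    with step_send show thesis by (intro y1[of True]) (auto simp: letter_msg_def)
  next
    assume "a = 4"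
    with step_send show thesis by (intro x2[of False]) auto
  next
    assume "a = 5"
    with step_send show thesis by (intro x2[of True]) auto
  next
    assume "a = 6"
    with step_send show thesis by (intro g6) auto
  next
    assume "a = 7"
    with step_send show thesis by (intro g7) auto
  next
    assume "a = 8"
    with step_send show thesis by (intro y3) auto
  next
    assume "a = 9"
    with step_send show thesis by (intro c9) (auto dest: checker_send[OF T])
  qed
next
  case (step_recv j a k w q)
  have "a < 10"
    using trans_of_msg[OF T step_recv(6)] src_dst_bound(2) step_recv(4) by blast
  then show thesis
  proof (rule less_10_cases)
    assume "a = 0"
    with step_recv show thesis by (intro cl[of "(True, False)" q w]) (auto simp: letter_msg_def dest: checker_recv[OF T])
  next
    assume "a = Suc 0"
    with step_recv show thesis by (intro cl[of "(True, True)" q w]) (auto simp: letter_msg_def dest: checker_recv[OF T])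
  next
    assume "a = 2"
    with step_recv show thesis by (intro cl[of "(False, False)" q w]) (auto simp: letter_msg_def dest: checker_recv[OF T])
  next
    assume "a = 3"
    with step_recv show thesis by (intro cl[of "(False, True)" q w]) (auto simp: letter_msg_def dest: checker_recv[OF T])
  next
    assume "a = 4"
    with step_recv show thesis by (intro y0[of False w]) auto
  next
    assume "a = 5"
    with step_recv show thesis by (intro y0[of True w]) auto
  next
    assume "a = 6"
    with step_recv show thesis by (intro c6[of w]) (auto dest: checker_recv[OF T])
  next
    assume "a = 7"
    with step_recv show thesis by (intro x7[of w]) auto
  next
    assume "a = 8"
    with step_recv show thesis by (intro g8[of w]) auto
  next
    assume "a = 9"
    with step_recv show thesis by auto
  qed
qed

section \<open>Simulation of asynchronous by synchronous runs\<close>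

text \<open>Equal streams mean that both heads start at the beginning of the word, with an empty
  queue between them.\<close>

definition accepts :: "nat \<Rightarrow> (nat \<times> action \<times> nat) list \<Rightarrow> bool" where
  "accepts i T \<longleftrightarrow> (\<exists>w n. acc (letter_trans T) n i (w, w))"

lemma reads_append: "reads l c c' \<Longrightarrow> reads l (fst c @ u, snd c @ v) (fst c' @ u, snd c' @ v)"
  by (cases l; cases c; cases c') (auto split: if_splits)

text \<open>One-way heads do not see what follows the letters they read, so a path survives when the
  ring sends more letters.\<close>

lemma hstep_append:
  assumes "((p, (a, b)), (q, (a', b'))) \<in> (hstep T)\<^sup>*"
  shows "((p, (a @ u, b @ v)), (q, (a' @ u, b' @ v))) \<in> (hstep T)\<^sup>*"
proof -
  have "((fst X, (fst (snd X) @ u, snd (snd X) @ v)), (fst Y, (fst (snd Y) @ u, snd (snd Y) @ v))) \<in> (hstep T)\<^sup>*"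
    if "(X, Y) \<in> (hstep T)\<^sup>*" for X Y
    using that
  proof (induction rule: rtrancl_induct)
    case (step Y Z)
    from step.hyps(2) have "((fst Y, (fst (snd Y) @ u, snd (snd Y) @ v)),
        (fst Z, (fst (snd Z) @ u, snd (snd Z) @ v))) \<in> hstep T"
      unfolding hstep_def using reads_append by (auto simp del: split_paired_Ex reads.simps)
    with step.IH show ?case
      by (rule rtrancl_into_rtrancl)
  qed simp
  from this[OF assms] show ?thesis
    by simp
qed

text \<open>The first six arguments are the states and channel contents of the ring in an asynchronous run,
  the next three the states after delivery of the pending messages, and the last one is the letter
  that the checker has been sent by peer 3 but not yet by peer 4.\<close>

inductive ring_phase :: "nat \<Rightarrow> nat \<Rightarrow> nat \<Rightarrow> nat list \<Rightarrow> nat list \<Rightarrow> nat list \<Rightarrow>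
    nat \<Rightarrow> nat \<Rightarrow> nat \<Rightarrow> bool list \<Rightarrow> bool" where
  "ring_phase 0 0 0 [] [] [] 0 0 0 []"
| "ring_phase 1 0 0 [] [] [] 1 0 0 []"
| "ring_phase 2 0 0 [7] [] [] 2 1 0 []"
| "ring_phase 2 1 0 [] [] [] 2 1 0 []"
| "ring_phase 2 (2 + of_bool b) 0 [] [] [] 2 (2 + of_bool b) 0 [b]"
| "ring_phase 2 0 0 [] [4 + of_bool b] [] 2 0 (1 + of_bool b) [b]"
| "ring_phase 2 0 (1 + of_bool b) [] [] [] 2 0 (1 + of_bool b) [b]"
| "ring_phase 2 0 3 [] [] [] 2 0 3 []"
| "ring_phase 2 0 0 [] [] [8] 1 0 0 []"

text \<open>As long as the checker has not read the garbage 6, the configuration is not stable, so it does no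
  harm that its synchronous counterpart is already in the sink.\<close>

inductive sync_sim :: "nat \<Rightarrow> (nat \<times> action \<times> nat) list \<Rightarrow> config \<Rightarrow> config \<Rightarrow> bool"
  for i :: nat and T :: "(nat \<times> action \<times> nat) list" where
  sync_simI: "ring_phase g x y (ch (2, 3)) (ch (3, 4)) (ch (4, 2)) g' x' y' pend \<Longrightarrow>
    ch (3, 1) = map (\<lambda>b. letter_msg (True, b)) u \<Longrightarrow>
    ch (4, 1) = map (\<lambda>b. letter_msg (False, b)) v \<Longrightarrow>
    (g = 0 \<and> c = i \<and> c' = i \<and> ch (2, 1) = [] \<and> u = [] \<and> v = []) \<or>
    (g \<noteq> 0 \<and> c' = 3 \<and> (ch (2, 1) = [6] \<or> ch (2, 1) = [] \<and> c = 3)) \<Longrightarrow>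
    (c \<noteq> 3 \<Longrightarrow> \<exists>w. ((i, (w, w)), (c, (u, v @ pend))) \<in> (hstep (letter_trans T))\<^sup>*) \<Longrightarrow>
    (\<And>j k. (j, k) \<notin> {(2, 1), (3, 1), (4, 1), (2, 3), (3, 4), (4, 2)} \<Longrightarrow> ch (j, k) = []) \<Longrightarrow>
    sync_sim i T (c # g # x # y # replicate padding 0, ch) (c' # g' # x' # y' # replicate padding 0, \<lambda>_. [])"

lemma sync_sim_init:
  "sync_sim i T (init_config (ring_system (i, T))) (init_config (ring_system (i, T)))"
proof -
  have "init_config (ring_system (i, T)) = (i # 0 # 0 # 0 # replicate padding 0, \<lambda>_. [])"
    by (simp add: init_config_def ring_system_def peers_def ring_peers_def)
  then show ?thesis
    by (auto intro!: sync_simI[where u = "[]" and v = "[]" and pend = "[]"] ring_phase.intros(1))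
qed

text \<open>With empty ring channels only phases without pending delivery remain. An empty channel
  from peer 2 to peer 1 means that the garbage is unsent or consumed, and then both checker states
  coincide.\<close>

lemma sync_sim_stable:
  assumes "sync_sim i T cfg cfg'" "stable cfg"
  shows "cfg' = cfg"
  using assms(1)
proof cases
  case (sync_simI g x y ch g' x' y' pend u v c c')
  from assms(2) have ch: "ch = (\<lambda>_. [])"
    unfolding sync_simI(1) stable_def by (auto simp: fun_eq_iff)
  from sync_simI(3) have "g' = g \<and> x' = x \<and> y' = y"
    by cases (simp_all add: ch)
  moreover have "c' = c"
    using sync_simI(6) by (auto simp: ch)
  ultimately show ?thesis
    by (simp add: sync_simI(1,2) ch)
qed

lemma run_pair:
  assumes "(st ! (src S a - 1), (True, a), q) \<in> trans_of S (src S a)"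
    "st' = st[src S a - 1 := q]" "(st' ! (dst S a - 1), (False, a), q') \<in> trans_of S (dst S a)"
    "st'' = st'[dst S a - 1 := q']"
  shows "run S (st, \<lambda>_. []) [(True, a), (False, a)] (st'', \<lambda>_. [])"
proof -
  let ?i = "src S a" and ?j = "dst S a"
  have "step S (st, \<lambda>_. []) (True, a) (st', (\<lambda>_. [])((?i, ?j) := [a]))"
    using step_send[OF refl refl assms(1), of "\<lambda>_. []"] assms(2) by simp
  moreover have "step S (st', (\<lambda>_. [])((?i, ?j) := [a])) (False, a) (st'', \<lambda>_. [])"
  proof -
    have "step S (st', (\<lambda>_. [])((?i, ?j) := [a])) (False, a)
        (st'[?j - 1 := q'], ((\<lambda>_. [])((?i, ?j) := [a]))((?i, ?j) := []))"
      by (rule step_recv) (use assms(3) in auto)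
    moreover have "((\<lambda>_. [])((?i, ?j) := [a]))((?i, ?j) := []) = (\<lambda>_. [])"
      by auto
    ultimately show ?thesis
      using assms(4) by simp
  qed
  ultimately show ?thesis
    by (auto intro: run.intros)
qed

lemma synchronous_Nil [simp]: "synchronous []"
  unfolding synchronous_def by (rule exI[of _ "[]"]) simp

lemma synchronous_pair [simp]: "synchronous [(True, a), (False, a)]"
  unfolding synchronous_def by (rule exI[of _ "[a]"]) simp

lemma synchronous_append:
  assumes "synchronous s" "synchronous t"
  shows "synchronous (s @ t)"
proof -
  from assms obtain as bs where "s = concat (map (\<lambda>a. [(True, a), (False, a)]) as)"
    "t = concat (map (\<lambda>a. [(True, a), (False, a)]) bs)"
    unfolding synchronous_def by blast
  then show ?thesis
    unfolding synchronous_def by (intro exI[of _ "as @ bs"]) simp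
qed

lemma run_append: "run S c s c' \<Longrightarrow> run S c' t c'' \<Longrightarrow> run S c (s @ t) c''"
  by (induction rule: run.induct) (auto intro: run.intros)

lemma of_bool_eq_Suc_0: "of_bool b = Suc 0 \<longleftrightarrow> b" "Suc 0 = of_bool b \<longleftrightarrow> b" "of_bool b \<noteq> (2 :: nat)"
  by simp_all

lemma ring_phase_x2:
  assumes "ring_phase g (2 + of_bool b) y c23 c34 c42 g' x' y' pend"
  shows "g = 2 \<and> y = 0 \<and> g' = 2 \<and> x' = 2 + of_bool b \<and> y' = 0 \<and> pend = [b] \<and> c23 = [] \<and> c34 = [] \<and> c42 = []"
  using assms by cases (auto simp: of_bool_eq_Suc_0)

lemma ring_phase_y0:
  assumes "ring_phase g x 0 c23 ((4 + of_bool b) # w) c42 g' x' y' pend"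
  shows "g = 2 \<and> x = 0 \<and> g' = 2 \<and> x' = 0 \<and> y' = 1 + of_bool b \<and> pend = [b] \<and> c23 = [] \<and> w = [] \<and> c42 = []"
  using assms by cases (auto simp: of_bool_eq_Suc_0)

lemma ring_phase_y1:
  assumes "ring_phase g x (1 + of_bool b) c23 c34 c42 g' x' y' pend"
  shows "g = 2 \<and> x = 0 \<and> g' = 2 \<and> x' = 0 \<and> y' = 1 + of_bool b \<and> pend = [b] \<and> c23 = [] \<and> c34 = [] \<and> c42 = []"
  using assms by cases (auto simp: of_bool_eq_Suc_0)

lemma ring_phase_y3:
  assumes "ring_phase g x 3 c23 c34 c42 g' x' y' pend"
  shows "g = 2 \<and> x = 0 \<and> g' = 2 \<and> x' = 0 \<and> y' = 3 \<and> pend = [] \<and> c23 = [] \<and> c34 = [] \<and> c42 = []"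
  using assms by cases (auto simp: of_bool_eq_Suc_0)

text \<open>A send is answered by sending and receiving the same message at once, and a receive by
  no action, because the counterpart took the message when it was sent.\<close>

lemma sync_sim_step:
  assumes T: "checker i T" and na: "\<not> accepts i T"
    and sim: "sync_sim i T cfg cfg'" and step: "step (ring_system (i, T)) cfg act cfg2"
  shows "\<exists>t cfg2'. synchronous t \<and> run (ring_system (i, T)) cfg' t cfg2' \<and> sends t = sends [act] \<and>
    sync_sim i T cfg2 cfg2'"
  using sim
proof cases
  case (sync_simI g x y ch g' x' y' pend u v c c')
  let ?S = "ring_system (i, T)" and ?L = "letter_trans T"
  note sim = sync_simI
  have recv: ?thesis if "act = (False, m)" "sync_sim i T cfg2 cfg'" for m
    using that by (intro exI[of _ "[]"] exI[of _ cfg']) (auto simp: sends_def intro: run_Nil)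
  have send: ?thesis
    if "act = (True, a)" "run ?S cfg' [(True, a), (False, a)] cfg2'" "sync_sim i T cfg2 cfg2'" for a cfg2'
    using that by (intro exI[of _ "[(True, a), (False, a)]"] exI[of _ cfg2']) (auto simp: sends_def)
  have sink: "(3, (False, m), 3) \<in> set T" if "m < 4" for m
    using T that unfolding checker_def by blast
  from T step[unfolded sim(1)] show ?thesis
  proof (cases rule: ring_step_cases)
    case g6
    have ph: "x = 0" "y = 0" "g' = 0" "x' = 0" "y' = 0" "pend = []" "ch (2, 3) = []" "ch (3, 4) = []" "ch (4, 2) = []"
      using sim(3) g6(2) by (cases; simp)+
    from g6 sim(6) have c: "c' = i" "c = i" "ch (2, 1) = []" "u = []" "v = []"
      by auto
    show ?thesis
    proof (rule send)
      show "act = (True, 6)" by fact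
      \<comment> \<open>Here the two runs part: the counterpart enters the sink, while the checker
        can still ignore the garbage.\<close>
      show "run ?S cfg' [(True, 6), (False, 6)] (3 # 1 # 0 # 0 # replicate padding 0, \<lambda>_. [])"
        unfolding sim(2) using T by (intro run_pair) (auto simp: ph c checker_def)
      show "sync_sim i T cfg2 (3 # 1 # 0 # 0 # replicate padding 0, \<lambda>_. [])"
        unfolding g6(3)
        by (rule sync_sim.sync_simI[where u = u and v = v and pend = pend])
          (use sim(4-) c ph ring_phase.intros(2) in auto)
    qed
  next
    case g7
    have ph: "x = 0" "y = 0" "g' = 1" "x' = 0" "y' = 0" "pend = []" "ch (2, 3) = []" "ch (3, 4) = []" "ch (4, 2) = []"
      using sim(3) g7(2) by (cases; simp)+
    show ?thesis
    proof (rule send)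
      show "act = (True, 7)" by fact
      show "run ?S cfg' [(True, 7), (False, 7)] (c' # 2 # 1 # 0 # replicate padding 0, \<lambda>_. [])"
        unfolding sim(2) by (intro run_pair) (auto simp: ph)
      show "sync_sim i T cfg2 (c' # 2 # 1 # 0 # replicate padding 0, \<lambda>_. [])"
        unfolding g7(3)
        by (rule sync_sim.sync_simI[where u = u and v = v and pend = pend])
          (use sim(4-) ph g7 ring_phase.intros(3) in auto)
    qed
  next
    case (g8 w)
    have ph: "x = 0" "y = 0" "g' = 1" "x' = 0" "y' = 0" "pend = []" "ch (2, 3) = []" "ch (3, 4) = []" "w = []"
      using sim(3) g8(2,3) by (cases; simp)+
    show ?thesis
    proof (rule recv)
      show "act = (False, 8)" by fact
      show "sync_sim i T cfg2 cfg'"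
        unfolding g8(4) sim(2)
        by (rule sync_sim.sync_simI[where u = u and v = v and pend = pend])
          (use sim(4-) ph g8 ring_phase.intros(2) in auto)
    qed
  next
    case (x7 w)
    have ph: "g = 2" "y = 0" "g' = 2" "x' = 1" "y' = 0" "pend = []" "w = []" "ch (3, 4) = []" "ch (4, 2) = []"
      using sim(3) x7(2,3) by (cases; simp)+
    show ?thesis
    proof (rule recv)
      show "act = (False, 7)" by fact
      show "sync_sim i T cfg2 cfg'"
        unfolding x7(4) sim(2)
        by (rule sync_sim.sync_simI[where u = u and v = v and pend = pend])
          (use sim(4-) ph x7 ring_phase.intros(4) in auto)
    qed
  next
    case (x1 b)
    have ph: "g = 2" "y = 0" "g' = 2" "x' = 1" "y' = 0" "pend = []" "ch (2, 3) = []" "ch (3, 4) = []" "ch (4, 2) = []"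
      using sim(3) x1(2) by (cases; simp)+
    with sim(6) have c: "c' = 3" by simp
    \<comment> \<open>The new letter extends the word: it enters \<open>u\<close> at once and, as
      the new \<open>pend\<close>, the stream of the trailing head.\<close>
    have w: "\<exists>w. ((i, (w, w)), (c, (u @ [b], v @ [b]))) \<in> (hstep ?L)\<^sup>*" if "c \<noteq> 3"
      using hstep_append[of i _ _ c u v ?L "[b]" "[b]"] sim(7)[OF that] ph(6) by fastforce
    show ?thesis
    proof (rule send)
      show "act = (True, letter_msg (True, b))" by fact
      show "run ?S cfg' [(True, letter_msg (True, b)), (False, letter_msg (True, b))]
          (3 # 2 # (2 + of_bool b) # 0 # replicate padding 0, \<lambda>_. [])"
        unfolding sim(2) using sink by (cases b; intro run_pair) (auto simp: ph c letter_msg_def)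
      show "sync_sim i T cfg2 (3 # 2 # (2 + of_bool b) # 0 # replicate padding 0, \<lambda>_. [])"
        unfolding x1(3)
        by (rule sync_sim.sync_simI[where u = "u @ [b]" and v = v and pend = "[b]"])
          (use sim(4-) ph c w ring_phase.intros(5)[of b] in auto)
    qed
  next
    case (x2 b)
    have ph: "g = 2" "y = 0" "g' = 2" "x' = 2 + of_bool b" "y' = 0" "pend = [b]" "ch (2, 3) = []" "ch (3, 4) = []" "ch (4, 2) = []"
      using ring_phase_x2 sim(3)[unfolded x2(2)] by blast+
    show ?thesis
    proof (rule send)
      show "act = (True, 4 + of_bool b)" by fact
      show "run ?S cfg' [(True, 4 + of_bool b), (False, 4 + of_bool b)]
          (c' # 2 # 0 # (1 + of_bool b) # replicate padding 0, \<lambda>_. [])"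
        unfolding sim(2) by (cases b; intro run_pair) (auto simp: ph)
      show "sync_sim i T cfg2 (c' # 2 # 0 # (1 + of_bool b) # replicate padding 0, \<lambda>_. [])"
        unfolding x2(3)
        by (rule sync_sim.sync_simI[where u = u and v = v and pend = "[b]"])
          (use sim(4-) ph ring_phase.intros(6)[of b] in auto)
    qed
  next
    case (y0 b w)
    have ph: "g = 2" "x = 0" "g' = 2" "x' = 0" "y' = 1 + of_bool b" "pend = [b]" "ch (2, 3) = []" "w = []" "ch (4, 2) = []"
      using ring_phase_y0 sim(3)[unfolded y0(2,3)] by blast+
    show ?thesis
    proof (rule recv)
      show "act = (False, 4 + of_bool b)" by fact
      show "sync_sim i T cfg2 cfg'"
        unfolding y0(4) sim(2)
        by (rule sync_sim.sync_simI[where u = u and v = v and pend = pend])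
          (use sim(4-) ph y0 ring_phase.intros(7)[of b] in auto)
    qed
  next
    case (y1 b)
    have ph: "g = 2" "x = 0" "g' = 2" "x' = 0" "y' = 1 + of_bool b" "pend = [b]" "ch (2, 3) = []" "ch (3, 4) = []" "ch (4, 2) = []"
      using ring_phase_y1 sim(3)[unfolded y1(2)] by blast+
    with sim(6) have c: "c' = 3" by simp
    show ?thesis
    proof (rule send)
      show "act = (True, letter_msg (False, b))" by fact
      show "run ?S cfg' [(True, letter_msg (False, b)), (False, letter_msg (False, b))]
          (3 # 2 # 0 # 3 # replicate padding 0, \<lambda>_. [])"
        unfolding sim(2) using sink by (cases b; intro run_pair) (auto simp: ph c letter_msg_def)
      show "sync_sim i T cfg2 (3 # 2 # 0 # 3 # replicate padding 0, \<lambda>_. [])"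
        unfolding y1(3)
        \<comment> \<open>The letter moves from \<open>pend\<close> to \<open>v\<close>; hence
          \<open>v @ pend\<close> and the path of the heads are unchanged.\<close>
        by (rule sync_sim.sync_simI[where u = u and v = "v @ [b]" and pend = "[]"])
          (use sim(4-) ph c ring_phase.intros(8) in auto)
    qed
  next
    case y3
    have ph: "g = 2" "x = 0" "g' = 2" "x' = 0" "y' = 3" "pend = []" "ch (2, 3) = []" "ch (3, 4) = []" "ch (4, 2) = []"
      using ring_phase_y3 sim(3)[unfolded y3(2)] by blast+
    show ?thesis
    proof (rule send)
      show "act = (True, 8)" by fact
      show "run ?S cfg' [(True, 8), (False, 8)] (c' # 1 # 0 # 0 # replicate padding 0, \<lambda>_. [])"
        unfolding sim(2) by (intro run_pair) (auto simp: ph)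
      show "sync_sim i T cfg2 (c' # 1 # 0 # 0 # replicate padding 0, \<lambda>_. [])"
        unfolding y3(3)
        by (rule sync_sim.sync_simI[where u = u and v = v and pend = "[]"])
          (use sim(4-) ph ring_phase.intros(9) in auto)
    qed
  next
    case (c6 w)
    \<comment> \<open>The checker joins its counterpart in the sink; from here on a stable
      configuration is the same in both runs.\<close>
    with sim(6) have c: "g \<noteq> 0" "c' = 3" "w = []"
      by auto
    show ?thesis
    proof (rule recv)
      show "act = (False, 6)" by fact
      show "sync_sim i T cfg2 cfg'"
        unfolding c6(4) sim(2)
        by (rule sync_sim.sync_simI[where u = u and v = v and pend = pend]) (use sim(3-) c in auto)
    qed
  next
    case (cl l q w)
    have g: "g \<noteq> 0" "c' = 3" "ch (2, 1) = [6] \<or> ch (2, 1) = [] \<and> c = 3"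
      using sim(4,5,6) cl(4) by (auto split: if_splits)
    have ch: "(ch((if fst l then 3 else 4, 1) := w)) (2, 1) = ch (2, 1)"
      "(ch((if fst l then 3 else 4, 1) := w)) (2, 3) = ch (2, 3)"
      "(ch((if fst l then 3 else 4, 1) := w)) (3, 4) = ch (3, 4)"
      "(ch((if fst l then 3 else 4, 1) := w)) (4, 2) = ch (4, 2)"
      by auto
    obtain u' v' where uv: "reads l (u, v) (u', v')"
      "(ch((if fst l then 3 else 4, 1) := w)) (3, 1) = map (\<lambda>b. letter_msg (True, b)) u'"
      "(ch((if fst l then 3 else 4, 1) := w)) (4, 1) = map (\<lambda>b. letter_msg (False, b)) v'"
    proof (cases "fst l")
      case True
      with cl(4) sim(4) have "map (\<lambda>b. letter_msg (True, b)) u = letter_msg l # w"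
        by simp
      then obtain b u' where u: "u = b # u'" "letter_msg (True, b) = letter_msg l"
        "map (\<lambda>b. letter_msg (True, b)) u' = w"
        unfolding map_eq_Cons_conv by blast
      from True u(2) have "l = (True, b)"
        by (cases "snd l"; cases b) (simp_all add: letter_msg_def prod_eq_iff)
      then show thesis
        by (intro that[of u' v]) (use u sim(5) in simp_all)
    next
      case False
      with cl(4) sim(5) have "map (\<lambda>b. letter_msg (False, b)) v = letter_msg l # w"
        by simp
      then obtain b v' where v: "v = b # v'" "letter_msg (False, b) = letter_msg l"
        "map (\<lambda>b. letter_msg (False, b)) v' = w"
        unfolding map_eq_Cons_conv by blast
      from False v(2) have "l = (False, b)"
        by (cases "snd l"; cases b) (simp_all add: letter_msg_def prod_eq_iff)
      then show thesis
        by (intro that[of u v']) (use v sim(4) in simp_all)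
    qed
    have path: "\<exists>w. ((i, (w, w)), (q, (u', v' @ pend))) \<in> (hstep ?L)\<^sup>*" if "q \<noteq> 3"
    proof -
      from that cl(3) have "c \<noteq> 3" by simp
      with cl(2) have "(c, l, q) \<in> ?L"
        unfolding letter_trans_def by (cases l) auto
      moreover have "reads l (u, v @ pend) (u', v' @ pend)"
        using reads_append[OF uv(1), of "[]" pend] by simp
      ultimately have "((c, (u, v @ pend)), (q, (u', v' @ pend))) \<in> hstep ?L"
        unfolding hstep_def by blast
      with sim(7)[OF \<open>c \<noteq> 3\<close>] show ?thesis
        by (blast intro: rtrancl_into_rtrancl)
    qed
    show ?thesis
    proof (rule recv)
      show "act = (False, letter_msg l)" by fact
      show "sync_sim i T cfg2 cfg'"
        unfolding cl(5) sim(2)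
      proof (rule sync_sim.sync_simI[where u = u' and v = v' and pend = pend])
        show "(ch((if fst l then 3 else 4, 1) := w)) (j, k) = []"
          if "(j, k) \<notin> {(2, 1), (3, 1), (4, 1), (2, 3), (3, 4), (4, 2)}" for j k
          using sim(8)[OF that] that by auto
        show "ring_phase g x y ((ch((if fst l then 3 else 4, 1) := w)) (2, 3)) ((ch((if fst l then 3 else 4, 1) := w)) (3, 4))
            ((ch((if fst l then 3 else 4, 1) := w)) (4, 2)) g' x' y' pend"
          unfolding ch by (rule sim(3))
        show "(g = 0 \<and> q = i \<and> c' = i \<and> (ch((if fst l then 3 else 4, 1) := w)) (2, 1) = [] \<and> u' = [] \<and> v' = []) \<or>
            (g \<noteq> 0 \<and> c' = 3 \<and> ((ch((if fst l then 3 else 4, 1) := w)) (2, 1) = [6] \<or>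
              (ch((if fst l then 3 else 4, 1) := w)) (2, 1) = [] \<and> q = 3))"
          unfolding ch using g cl(3) by blast
      qed (fact uv(2) uv(3) path)+
    qed
  next
    case c9
    then have "c \<noteq> 3" by simp
    \<comment> \<open>Message 9 is sent in state 1 only, so the path kept in the invariant is an
      accepting run on the letters sent so far.\<close>
    with sim(7) obtain w where "((i, (w, w)), (1, (u, v @ pend))) \<in> (hstep ?L)\<^sup>*"
      using c9(2) by blast
    then have "accepts i T"
      unfolding accepts_def acc_def rtrancl_power by blast
    with na show ?thesis by simp
  qed
qed

lemma sync_sim_run:
  assumes T: "checker i T" and na: "\<not> accepts i T"
    and "run (ring_system (i, T)) cfg t cfg2" "sync_sim i T cfg cfg'"
  shows "\<exists>t' cfg2'. synchronous t' \<and> run (ring_system (i, T)) cfg' t' cfg2' \<and> sends t' = sends t \<and>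
    sync_sim i T cfg2 cfg2'"
  using assms(3,4)
proof (induction "ring_system (i, T)" cfg t cfg2 arbitrary: cfg' rule: run.induct)
  case (run_Nil c)
  then show ?case
    by (intro exI[of _ "[]"] exI[of _ cfg']) (auto intro: run.run_Nil)
next
  case (run_Cons c x c1 t c2)
  from sync_sim_step[OF T na run_Cons.prems run_Cons.hyps(1)] obtain t1 c1' where 1:
    "synchronous t1" "run (ring_system (i, T)) cfg' t1 c1'" "sends t1 = sends [x]" "sync_sim i T c1 c1'"
    by blast
  from run_Cons.hyps(3)[OF 1(4)] obtain t2 c2' where 2:
    "synchronous t2" "run (ring_system (i, T)) c1' t2 c2'" "sends t2 = sends t" "sync_sim i T c2 c2'"
    by blast
  have "sends (t1 @ t2) = sends (x # t)"
    using 1(3) 2(3) by (simp add: sends_def)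
  with 1 2 show ?case
    by (meson run_append synchronous_append)
qed

section \<open>Acceptance and synchronizability\<close>

text \<open>The channels of the operational semantics hold the buffer words of the trace; thus every
  executable trace is FIFO.\<close>

lemma run_fifo:
  assumes "run S c t c'"
  shows "snd c (i, j) @ sent_on S i j t = recv_on S i j t @ snd c' (i, j)"
  using assms
proof (induction rule: run.induct)
  case (run_Nil S c)
  then show ?case by (simp add: sent_on_def recv_on_def)
next
  case (run_Cons S c x c' t c'')
  from run_Cons.hyps(1) run_Cons.IH show ?case
    by cases (auto simp: sent_on_def recv_on_def split: if_splits)
qed

lemma run_take:
  assumes "run S c t c'"
  shows "\<exists>c''. run S c (take m t) c''"
  using assms
proof (induction arbitrary: m rule: run.induct)
  case (run_Nil S c)
  show ?case by (simp del: split_paired_Ex) (blast intro: run.run_Nil)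
next
  case (run_Cons S c x c' t c'')
  then show ?case
    by (cases m) (simp_all del: split_paired_Ex, (blast intro: run.intros)+)
qed

lemma traces_omega_iff: "t \<in> traces_omega S \<longleftrightarrow> (\<exists>c. run S (init_config S) t c)"
proof
  assume "\<exists>c. run S (init_config S) t c"
  then obtain c where c: "run S (init_config S) t c" ..
  \<comment> \<open>A trace cannot buffer more messages than it has actions. \<open>Suc\<close>
    keeps the bound positive, as 0 would select the synchronous traces.\<close>
  have "k_bounded_fifo S (Suc (length t)) t"
    unfolding k_bounded_fifo_def
  proof (intro allI impI)
    fix m i j
    from run_take[OF c] obtain c' where c': "run S (init_config S) (take m t) c'"
      by blast
    have "sent_on S i j (take m t) = recv_on S i j (take m t) @ snd c' (i, j)"
      using run_fifo[OF c', of i j] by (simp add: init_config_def)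
    moreover have "length (sent_on S i j (take m t)) \<le> length t"
      unfolding sent_on_def length_map
      by (rule order_trans[OF length_filter_le]) simp
    ultimately show "\<exists>w. sent_on S i j (take m t) = recv_on S i j (take m t) @ w \<and> length w \<le> Suc (length t)"
      by (intro exI[of _ "snd c' (i, j)"]) simp
  qed
  then have "t \<in> traces S (Suc (length t))"
    using c unfolding traces_def by (simp del: split_paired_Ex) blast
  moreover have "Suc (length t) \<in> {1..}"
    by simp
  ultimately show "t \<in> traces_omega S"
    unfolding traces_omega_def by blast
qed (auto simp: traces_omega_def traces_def)

lemma traces_0_iff: "t \<in> traces S 0 \<longleftrightarrow> synchronous t \<and> (\<exists>c. run S (init_config S) t c)"
  by (simp add: traces_def)

lemma synchronizable_imp_language: "synchronizable S \<Longrightarrow> language_synchronizable S"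
proof -
  have "sends ` Ts = {w. Word w \<in> ST_of S Ts}" for Ts
    by (auto simp: ST_of_def)
  then show "synchronizable S \<Longrightarrow> language_synchronizable S"
    by (simp add: synchronizable_def language_synchronizable_def)
qed

lemma synchronizable_if_not_accepts:
  assumes T: "checker i T" and "\<not> accepts i T"
  shows "synchronizable (ring_system (i, T))"
  unfolding synchronizable_def
proof (intro equalityI subsetI)
  let ?S = "ring_system (i, T)"
  fix ob assume "ob \<in> ST_of ?S (traces ?S 0)"
  then show "ob \<in> ST_of ?S (traces_omega ?S)"
    unfolding ST_of_def using traces_0_iff traces_omega_iff by blast
next
  let ?S = "ring_system (i, T)"
  have *: "\<exists>t'\<in>traces ?S 0. sends t' = sends t \<and> (stable c \<longrightarrow> run ?S (init_config ?S) t' c)"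
    if run: "run ?S (init_config ?S) t c" for t c
  proof -
    from sync_sim_run[OF assms run sync_sim_init] obtain t' c' where
      1: "synchronous t'" "run ?S (init_config ?S) t' c'" "sends t' = sends t" "sync_sim i T c c'"
      by blast
    then have "t' \<in> traces ?S 0"
      unfolding traces_0_iff by blast
    moreover have "c' = c" if "stable c"
      using sync_sim_stable[OF 1(4) that] .
    ultimately show ?thesis
      using 1(2,3) by blast
  qed
  fix ob assume "ob \<in> ST_of ?S (traces_omega ?S)"
  then consider t c where "ob = Word (sends t)" "run ?S (init_config ?S) t c"
    | t c where "ob = WordConf (sends t) c" "run ?S (init_config ?S) t c" "stable c"
    unfolding ST_of_def using traces_omega_iff by blast
  then show "ob \<in> ST_of ?S (traces ?S 0)"
  proof cases
    case 1
    with *[OF 1(2)] obtain t' where "t' \<in> traces ?S 0" "sends t' = sends t"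
      by blast
    then have "Word (sends t') \<in> ST_of ?S (traces ?S 0)"
      unfolding ST_of_def by blast
    with 1(1) \<open>sends t' = sends t\<close> show ?thesis
      by simp
  next
    case 2
    with *[OF 2(2)] obtain t' where "t' \<in> traces ?S 0" "sends t' = sends t" "run ?S (init_config ?S) t' c"
      by blast
    then have "WordConf (sends t') c \<in> ST_of ?S (traces ?S 0)"
      unfolding ST_of_def using 2(3) by blast
    with 2(1) \<open>sends t' = sends t\<close> show ?thesis
      by simp
  qed
qed

section \<open>The signal of acceptance in synchronous and asynchronous runs\<close>

lemma step_pair_empty:
  assumes "step S (st, \<lambda>_. []) (True, a) c1" "step S c1 (False, a) c2"
  shows "snd c2 = (\<lambda>_. [])"
  using assms(1)
proof cases
  case (step_send i j q)
  from assms(2)[unfolded step_send(1)] show ?thesis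
    by cases (use step_send in \<open>auto simp: fun_eq_iff\<close>)
qed simp_all

lemma letter_msg_less: "letter_msg l \<noteq> 6" "6 \<noteq> letter_msg l"
  by (auto simp: letter_msg_def of_bool_def)

text \<open>Initially peers 3 and 4 wait and the checker, not being in state 1, sends nothing. So
  the garbage comes first, its reception leads into the sink, and from there 9 cannot be
  sent.\<close>

lemma sync_run_no_9:
  assumes T: "checker i T"
    and "run (ring_system (i, T)) (c # g # x # y # r, \<lambda>_. []) (concat (map (\<lambda>a. [(True, a), (False, a)]) as)) cfg"
    and "c = 3 \<or> c = i \<and> g = 0 \<and> x = 0 \<and> y = 0"
  shows "9 \<notin> set as"
  using assms(2,3)
proof (induction as arbitrary: c g x y)
  case (Cons a as)
  let ?S = "ring_system (i, T)"
  from Cons.prems(1) obtain c1 c2 where run: "step ?S (c # g # x # y # r, \<lambda>_. []) (True, a) c1"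
    "step ?S c1 (False, a) c2"
    "run ?S c2 (concat (map (\<lambda>a. [(True, a), (False, a)]) as)) cfg"
    by (auto elim!: run.cases[of S "_" "_ # _" for S])
  have c2: "snd c2 = (\<lambda>_. [])"
    using step_pair_empty run(1,2) .
  have c1: "a \<noteq> 9 \<and> (\<exists>g x y. fst c1 = c # g # x # y # r) \<and> (c \<noteq> 3 \<longrightarrow> a = 6)"
    using T run(1)
    by (cases rule: ring_step_cases) (use T Cons.prems(2) in \<open>auto simp: checker_def letter_msg_def of_bool_def split: if_splits\<close>)
  then obtain g1 x1 y1 ch1 where "c1 = (c # g1 # x1 # y1 # r, ch1)"
    by (cases c1) auto
  with run(2) have "step ?S (c # g1 # x1 # y1 # r, ch1) (False, a) c2"
    by simp
  with T have "\<exists>g x y. fst c2 = 3 # g # x # y # r"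
    by (cases rule: ring_step_cases) (use c1 letter_msg_less in \<open>auto simp: of_bool_eq_Suc_0\<close>)
  with c2 obtain g2 x2 y2 where "c2 = (3 # g2 # x2 # y2 # r, \<lambda>_. [])"
    by (cases c2) auto
  with Cons.IH[of 3 g2 x2 y2] run(3) c1 show ?case
    by simp
qed simp

text \<open>The garbage 6 stays in its channel throughout the accepting asynchronous run.\<close>

definition chan :: "bool list \<Rightarrow> bool list \<Rightarrow> nat list \<Rightarrow> nat list \<Rightarrow> nat list \<Rightarrow> nat \<times> nat \<Rightarrow> nat list" where
  "chan u v p q r = (\<lambda>_. [])((2, 1) := [6], (3, 1) := map (\<lambda>b. letter_msg (True, b)) u,
     (4, 1) := map (\<lambda>b. letter_msg (False, b)) v, (2, 3) := p, (3, 4) := q, (4, 2) := r)"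

lemma step_sendI:
  assumes "(st ! (src S a - 1), (True, a), q) \<in> trans_of S (src S a)"
    "st' = st[src S a - 1 := q]" "ch' = ch((src S a, dst S a) := ch (src S a, dst S a) @ [a])"
  shows "step S (st, ch) (True, a) (st', ch')"
  using step_send[OF refl refl assms(1)] assms(2,3) by simp

lemma step_recvI:
  assumes "(st ! (dst S a - 1), (False, a), q) \<in> trans_of S (dst S a)"
    "ch (src S a, dst S a) = a # w"
    "st' = st[dst S a - 1 := q]" "ch' = ch((src S a, dst S a) := w)"
  shows "step S (st, ch) (False, a) (st', ch')"
  using assms(1,2) unfolding assms(3,4) by (intro step_recv) simp_all

lemma broadcast_letter:
  "\<exists>t. run (ring_system P) (c # 1 # 0 # 0 # r, chan u v [] [] []) t
     (c # 1 # 0 # 0 # r, chan (u @ [b]) (v @ [b]) [] [] [])"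
proof -
  let ?S = "ring_system P" and ?m = "letter_msg (True, b)" and ?n = "letter_msg (False, b)"
  have "step ?S (c # 1 # 0 # 0 # r, chan u v [] [] []) (True, 7) (c # 2 # 0 # 0 # r, chan u v [7] [] [])"
    by (rule step_sendI) (auto simp: chan_def fun_eq_iff)
  moreover have "step ?S (c # 2 # 0 # 0 # r, chan u v [7] [] []) (False, 7) (c # 2 # 1 # 0 # r, chan u v [] [] [])"
    by (rule step_recvI) (auto simp: chan_def fun_eq_iff)
  moreover have "step ?S (c # 2 # 1 # 0 # r, chan u v [] [] []) (True, ?m)
      (c # 2 # (2 + of_bool b) # 0 # r, chan (u @ [b]) v [] [] [])"
    by (cases b; rule step_sendI) (auto simp: chan_def letter_msg_def fun_eq_iff)
  moreover have "step ?S (c # 2 # (2 + of_bool b) # 0 # r, chan (u @ [b]) v [] [] []) (True, 4 + of_bool b)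
      (c # 2 # 0 # 0 # r, chan (u @ [b]) v [] [4 + of_bool b] [])"
    by (cases b; rule step_sendI) (auto simp: chan_def fun_eq_iff)
  moreover have "step ?S (c # 2 # 0 # 0 # r, chan (u @ [b]) v [] [4 + of_bool b] []) (False, 4 + of_bool b)
      (c # 2 # 0 # (1 + of_bool b) # r, chan (u @ [b]) v [] [] [])"
    by (cases b; rule step_recvI) (auto simp: chan_def fun_eq_iff)
  moreover have "step ?S (c # 2 # 0 # (1 + of_bool b) # r, chan (u @ [b]) v [] [] []) (True, ?n)
      (c # 2 # 0 # 3 # r, chan (u @ [b]) (v @ [b]) [] [] [])"
    by (cases b; rule step_sendI) (auto simp: chan_def letter_msg_def fun_eq_iff)
  moreover have "step ?S (c # 2 # 0 # 3 # r, chan (u @ [b]) (v @ [b]) [] [] []) (True, 8)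
      (c # 2 # 0 # 0 # r, chan (u @ [b]) (v @ [b]) [] [] [8])"
    by (rule step_sendI) (auto simp: chan_def fun_eq_iff)
  moreover have "step ?S (c # 2 # 0 # 0 # r, chan (u @ [b]) (v @ [b]) [] [] [8]) (False, 8)
      (c # 1 # 0 # 0 # r, chan (u @ [b]) (v @ [b]) [] [] [])"
    by (rule step_recvI) (auto simp: chan_def fun_eq_iff)
  ultimately show ?thesis
    by (meson run.intros)
qed

text \<open>The whole word is sent before the checker reads any of it, so that afterwards both heads
  can move in any order without waiting for the ring.\<close>

lemma broadcast:
  "\<exists>t. run (ring_system P) (c # 1 # 0 # 0 # r, chan [] [] [] [] []) t
     (c # 1 # 0 # 0 # r, chan w w [] [] [])"
proof (induction w rule: rev_induct)
  case Nil
  show ?case by (blast intro: run_Nil)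
next
  case (snoc b w)
  with broadcast_letter[of P c r w w b] show ?case
    by (blast intro: run_append)
qed

lemma hstep_run:
  assumes "((p, (u, v)), (q, (u', v'))) \<in> (hstep (letter_trans T))\<^sup>*"
  shows "\<exists>t. run (ring_system (i, T)) (p # 1 # 0 # 0 # r, chan u v [] [] []) t
     (q # 1 # 0 # 0 # r, chan u' v' [] [] [])"
proof -
  have "\<exists>t. run (ring_system (i, T)) (fst X # 1 # 0 # 0 # r, chan (fst (snd X)) (snd (snd X)) [] [] []) t
     (fst Y # 1 # 0 # 0 # r, chan (fst (snd Y)) (snd (snd Y)) [] [] [])"
    if "(X, Y) \<in> (hstep (letter_trans T))\<^sup>*" for X Y
    using that
  proof (induction rule: converse_rtrancl_induct)
    case base
    show ?case by (blast intro: run_Nil)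
  next
    case (step X Z)
    obtain p u v q u' v' where XZ: "X = (p, u, v)" "Z = (q, u', v')"
      by (metis prod.exhaust)
    with step.hyps(1) obtain h b where l: "(p, (False, letter_msg (h, b)), q) \<in> set T"
      "reads (h, b) (u, v) (u', v')"
      by (auto simp: hstep_def letter_trans_def)
    have "step (ring_system (i, T)) (p # 1 # 0 # 0 # r, chan u v [] [] []) (False, letter_msg (h, b))
      (q # 1 # 0 # 0 # r, chan u' v' [] [] [])"
      by (cases h; cases b; rule step_recvI)
        (use l in \<open>auto simp: letter_msg_def chan_def fun_eq_iff\<close>)
    with step.IH show ?case
      unfolding XZ fst_conv snd_conv by (blast intro: run_Cons)
  qed
  from this[OF assms] show ?thesis
    by simp
qed

lemma not_language_synchronizable_if_accepts:
  assumes T: "checker i T" and "(1, (True, 9), 1) \<in> set T" and "accepts i T"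
  shows "\<not> language_synchronizable (ring_system (i, T))"
proof -
  let ?S = "ring_system (i, T)" and ?r = "replicate padding (0 :: nat)"
  have init: "init_config ?S = (i # 0 # 0 # 0 # ?r, \<lambda>_. [])"
    by (simp add: init_config_def ring_system_def peers_def ring_peers_def)
  from assms(3) obtain w u v where path: "((i, (w, w)), (1, (u, v))) \<in> (hstep (letter_trans T))\<^sup>*"
    unfolding accepts_def acc_def by (auto dest: relpow_imp_rtrancl)
  have "step ?S (init_config ?S) (True, 6) (i # 1 # 0 # 0 # ?r, chan [] [] [] [] [])"
    unfolding init by (rule step_sendI) (auto simp: chan_def fun_eq_iff)
  moreover obtain t1 where "run ?S (i # 1 # 0 # 0 # ?r, chan [] [] [] [] []) t1 (i # 1 # 0 # 0 # ?r, chan w w [] [] [])"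
    using broadcast by blast
  moreover obtain t2 where "run ?S (i # 1 # 0 # 0 # ?r, chan w w [] [] []) t2 (1 # 1 # 0 # 0 # ?r, chan u v [] [] [])"
    using hstep_run[OF path] by blast
  moreover have "step ?S (1 # 1 # 0 # 0 # ?r, chan u v [] [] []) (True, 9)
      (1 # 1 # 0 # 0 # ?r, (chan u v [] [] [])((1, 2) := [9]))"
    using assms(2) by (intro step_sendI) (auto simp: chan_def fun_eq_iff)
  ultimately have "\<exists>c. run ?S (init_config ?S) ((True, 6) # t1 @ t2 @ [(True, 9)]) c"
    by (meson run_append run.intros)
  then have "sends ((True, 6) # t1 @ t2 @ [(True, 9)]) \<in> sends ` traces_omega ?S"
    unfolding traces_omega_iff[symmetric] by (rule imageI)
  moreover have "9 \<in> set (sends ((True, 6) # t1 @ t2 @ [(True, 9)]))"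
    by (simp add: sends_def)
  moreover have "9 \<notin> set (sends t)" if t: "t \<in> traces ?S 0" for t
  proof -
    from t obtain as c where as: "t = concat (map (\<lambda>a. [(True, a), (False, a)]) as)"
      "run ?S (init_config ?S) t c"
      unfolding traces_0_iff synchronous_def by blast
    have "sends t = as"
      unfolding as(1) by (induction as) (simp_all add: sends_def)
    then show ?thesis
      using sync_run_no_9[OF T as(2)[unfolded as(1) init]] by simp
  qed
  ultimately have "sends ` traces ?S 0 \<noteq> sends ` traces_omega ?S"
    by (metis (no_types, lifting) imageE)
  then show ?thesis
    unfolding language_synchronizable_def .
qed

section \<open>Undecidability\<close>

lemma letter_msg_inject [simp]: "letter_msg l = letter_msg l' \<longleftrightarrow> l = l'"
  by (cases l; cases l') (auto simp: letter_msg_def of_bool_def split: if_splits)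

lemma letter_msg_bound: "letter_msg l < 4"
  by (auto simp: letter_msg_def of_bool_def)

lemma wf_ring_system:
  assumes "checker i T"
  shows "wf_system (ring_system (i, T))"
proof -
  let ?S = "ring_system (i, T)"
  have Sigma: "a < 10 \<Longrightarrow> a \<in> Sigma ?S" for a
    by (erule less_10_cases) (simp_all add: Sigma_def msgs_def ring_system_def ring_msgs_def)
  have C: "a \<in> Sigma ?S \<and> (if b then src ?S a = 1 else dst ?S a = 1)" if "(p, (b, a), q) \<in> set T" for p b a q
  proof (cases b)
    case True
    with checker_send[OF assms] that have "a = 9" by simp
    with True Sigma show ?thesis by auto
  next
    case False
    with checker_recv[OF assms] that have "a = 6 \<or> a < 4" by auto
    then have "a = 6 \<or> a = 0 \<or> a = Suc 0 \<or> a = 2 \<or> a = 3" by arith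
    with False Sigma show ?thesis by auto
  qed
  have peers: "(\<forall>(p, (b, a), q) \<in> set (snd (peers ?S ! k)).
      a \<in> Sigma ?S \<and> (if b then src ?S a = Suc k else dst ?S a = Suc k))" if "k < 4 + padding" for k
  proof -
    consider "k = 0" | "k = 1" | "k = 2" | "k = 3" | "4 \<le> k"
      by arith
    then show ?thesis
    proof cases
      case 1
      have "peers ?S ! 0 = (i, T)"
        by (simp add: peers_def ring_system_def)
      with 1 C show ?thesis
        by fastforce
    next
      case 5
      then have "peers ?S ! k = (0, [])"
        using that by (auto simp: peers_def ring_system_def nth_Cons' nth_append ring_peers_def)
      then show ?thesis by simp
    next
      case 2
      then have "peers ?S ! k = ring_peers ! 0"
        by (simp add: peers_def ring_system_def ring_peers_def)
      with 2 Sigma show ?thesis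
        by (auto simp: ring_peers_def)
    next
      case 3
      then have "peers ?S ! k = ring_peers ! 1"
        by (simp add: peers_def ring_system_def ring_peers_def)
      with 3 Sigma show ?thesis
        by (auto simp: ring_peers_def)
    next
      case 4
      then have "peers ?S ! k = ring_peers ! 2"
        by (simp add: peers_def ring_system_def ring_peers_def)
      with 4 Sigma show ?thesis
        by (auto simp: ring_peers_def)
    qed
  qed
  then show ?thesis
    unfolding wf_system_def
    by (auto simp: npeers_def msgs_def ring_system_def ring_msgs_def peers_def ring_peers_def)
qed

section \<open>The machine and the code of its system\<close>

primrec input_chain :: "nat \<Rightarrow> (nat \<times> action \<times> nat) list" where
  "input_chain 0 = []"
| "input_chain (Suc k) = (2 * Suc k, (False, 1), 2 * k) # input_chain k"

lemma set_input_chain: "set (input_chain e) = (\<lambda>k. (2 * Suc k, (False, 1), 2 * k)) ` {..<e}"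
  by (induction e) (auto simp: lessThan_Suc)

text \<open>The input is the length of the chain: each of its transitions reads message 1 and
  thereby enqueues one unary digit. The transitions \<open>P\<close> are thus the same for all
  inputs.\<close>

definition machine :: "(nat \<times> action \<times> nat) list \<Rightarrow> nat \<Rightarrow> system" where
  "machine P e = ring_system (2 * e, (2 * e, (False, 6), 3) # input_chain e @ P)"

text \<open>Puts the chain in front of a list that is given by its code \<open>c\<close> alone, so
  that no list has to be decoded.\<close>

primrec chain_code :: "nat \<Rightarrow> nat \<Rightarrow> nat" where
  "chain_code 0 c = c"
| "chain_code (Suc k) c = Suc (prod_encode (enc_trans (2 * Suc k, (False, 1), 2 * k), chain_code k c))"

lemma list_encode_input_chain:
  "list_encode (map enc_trans (input_chain k @ P)) = chain_code k (list_encode (map enc_trans P))"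
  by (induction k) simp_all

text \<open>Self-application happens in \<open>chain_code e e\<close>: \<open>e\<close> is both the
  length of the chain and the code of the transitions that follow it.\<close>

definition machine_code :: "nat \<Rightarrow> nat" where
  "machine_code e = prod_encode (4 + padding, prod_encode (list_encode (map enc_msg ring_msgs),
     Suc (prod_encode (prod_encode (2 * e,
            Suc (prod_encode (enc_trans (2 * e, (False, 6), 3), chain_code e e))),
       list_encode (map enc_aut (ring_peers @ replicate padding (0, [])))))))"

lemma enc_machine:
  assumes "e = list_encode (map enc_trans P)"
  shows "enc_system (machine P e) = machine_code e"
  using list_encode_input_chain[of e P] assms
  by (simp add: enc_system_def machine_def ring_system_def npeers_def msgs_def peers_def enc_aut_def
      machine_code_def)

text \<open>\<open>padding\<close> is unspecified, but it is one fixed number and hence a constant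
  of the recursive function.\<close>

lemma recursive_machine_code: "recursive 1 (\<lambda>xs. machine_code (xs ! 0))"
proof -
  have double: "recursive n (\<lambda>xs. 2 * A xs)" if "recursive n A" for n A
    using recursive_add[OF that that] by (simp add: mult_2)
  have "recursive (Suc 1) (\<lambda>xs. chain_code (xs ! 0) (xs ! 1))"
  proof (rule recursive_prim)
    show "recursive 1 (\<lambda>xs. xs ! 0)"
      by (rule recursive_nth) simp
    show "recursive (Suc (Suc 1)) (\<lambda>xs. Suc (prod_encode (enc_trans (2 * Suc (xs ! 0), (False, 1), 2 * (xs ! 0)), xs ! 1)))"
      unfolding enc_trans_def enc_action_def fst_conv snd_conv
      by (intro recursive_Suc recursive_prod_encode double recursive_const recursive_nth) simp_all
  qed simp_all
  then have chain: "recursive 2 (\<lambda>xs. chain_code (xs ! 0) (xs ! 1))"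
    by (simp add: numeral_2_eq_2)
  have nth: "recursive 1 (\<lambda>xs. xs ! 0)"
    by (rule recursive_nth) simp
  have "recursive 1 (\<lambda>xs. chain_code (xs ! 0) (xs ! 0))"
    using recursive_comp2[OF chain nth nth] by simp
  then show ?thesis
    unfolding machine_code_def enc_trans_def enc_action_def fst_conv snd_conv
    by (intro recursive_prod_encode recursive_Suc recursive_const double nth)
qed

lemma acc_input_chain:
  assumes L: "\<And>k l q. k < e \<Longrightarrow> (2 * Suc k, l, q) \<in> L \<longleftrightarrow> l = (True, True) \<and> q = 2 * k" and "k \<le> e"
  shows "(\<exists>n. acc L n (2 * k) (a, b)) \<longleftrightarrow> (\<exists>a' n. a = replicate k True @ a' \<and> acc L n 0 (a', b))"
  using assms(2)
proof (induction k arbitrary: a)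
  case (Suc k)
  have "acc L n (2 * Suc k) (a, b) \<longleftrightarrow> (\<exists>m a'. n = Suc m \<and> a = True # a' \<and> acc L m (2 * k) (a', b))" for n
  proof (cases n)
    case 0
    then show ?thesis by simp
  next
    case (Suc m)
    then show ?thesis
      using L[of k] \<open>Suc k \<le> e\<close> by (auto simp del: mult_Suc_right simp: acc_Suc)
  qed
  then have "(\<exists>n. acc L n (2 * Suc k) (a, b)) \<longleftrightarrow> (\<exists>a'. a = True # a' \<and> (\<exists>m. acc L m (2 * k) (a', b)))"
    by blast
  also have "\<dots> \<longleftrightarrow> (\<exists>a' n. a = replicate (Suc k) True @ a' \<and> acc L n 0 (a', b))"
    using Suc by auto
  finally show ?case .
qed simp

theorem machine_correct:
  obtains P where "\<And>e. checker (2 * e) ((2 * e, (False, 6), 3) # input_chain e @ P)"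
    "(1, (True, 9), 1) \<in> set P"
    "\<And>e. accepts (2 * e) ((2 * e, (False, 6), 3) # input_chain e @ P) \<longleftrightarrow> (\<exists>z. eval d [e] z)"
proof -
  obtain T p where T: "finite T" "p \<in> work_states" "fst ` T \<subseteq> work_states"
    "(snd \<circ> snd) ` T \<subseteq> insert 1 work_states"
    "\<And>T' n. agree work_states T T' \<Longrightarrow>
       (\<exists>w m. acc T' m p (w, enc_stack [n] @ w)) \<longleftrightarrow> (\<exists>z. eval d [n] z)"
    using recf_automaton[of d] by blast
  \<comment> \<open>State 0, where the chain ends, enqueues the terminator of the unary input and
    enters the compiled automaton at \<open>p\<close>. Parity keeps the chain apart from the odd
    states of \<open>T\<close>.\<close>
  define X where "X = (\<lambda>(v, l, x). (v, (False, letter_msg l), x)) ` T \<union>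
    {(0, (False, 0), p), (1, (True, 9), 1)} \<union> (\<lambda>m. (3, (False, m), 3)) ` {..<4}"
  have "finite X"
    using T(1) by (simp add: X_def)
  then obtain P where P: "set P = X"
    using finite_list by blast
  let ?M = "\<lambda>e. (2 * e, (False, 6), 3) # input_chain e @ P"
  have work: "v \<in> work_states \<Longrightarrow> odd v \<and> v \<noteq> 1 \<and> v \<noteq> 3" for v
    by (auto simp: work_states_def)
  have TX: "odd v \<and> v \<noteq> 1 \<and> v \<noteq> 3" "odd x \<and> x \<noteq> 3" if "(v, l, x) \<in> T" for v l x
  proof -
    from that T(3,4) have "v \<in> work_states" "x = 1 \<or> x \<in> work_states"
      by force+
    then show "odd v \<and> v \<noteq> 1 \<and> v \<noteq> 3" "odd x \<and> x \<noteq> 3"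
      using work by auto
  qed
  have even_neq: "2 * k \<noteq> (3 :: nat)" "2 * k \<noteq> (1 :: nat)" "2 * k \<noteq> Suc 0" for k
    by arith+
  have M: "(v, (b, m), x) \<in> set (?M e) \<longleftrightarrow>
      (v = 2 * e \<and> \<not> b \<and> m = 6 \<and> x = 3) \<or> (\<exists>k<e. v = 2 * Suc k \<and> \<not> b \<and> m = 1 \<and> x = 2 * k) \<or>
      (\<not> b \<and> (\<exists>l. m = letter_msg l \<and> (v, l, x) \<in> T)) \<or> (v = 0 \<and> \<not> b \<and> m = 0 \<and> x = p) \<or>
      (v = 1 \<and> b \<and> m = 9 \<and> x = 1) \<or> (v = 3 \<and> \<not> b \<and> m < 4 \<and> x = 3)" for v b m x e
    unfolding set_simps set_append P X_def set_input_chain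
    by (auto simp del: mult_Suc_right simp: image_iff)
  have "checker (2 * e) (?M e)" for e
    unfolding checker_def M
    using even_neq TX work[OF T(2)] letter_msg_bound by (auto simp del: mult_Suc_right) blast+
  moreover have "(1, (True, 9), 1) \<in> set P"
    by (simp add: P X_def)
  moreover have "accepts (2 * e) (?M e) \<longleftrightarrow> (\<exists>z. eval d [e] z)" for e
  proof -
    define L where "L = letter_trans (?M e)"
    have one: "letter_msg l = 1 \<longleftrightarrow> l = (True, True)" "letter_msg l = 0 \<longleftrightarrow> l = (True, False)" for l
      using letter_msg_inject[of l "(True, True)"] letter_msg_inject[of l "(True, False)"]
      by (simp_all add: letter_msg_def)
    have T3: "(3, l, x) \<notin> T" for l x
      using TX(1)[of 3 l x] by auto
    have L: "(v, l, x) \<in> L \<longleftrightarrow> (\<exists>k<e. v = 2 * Suc k \<and> l = (True, True) \<and> x = 2 * k) \<or>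
        (v, l, x) \<in> T \<or> (v = 0 \<and> l = (True, False) \<and> x = p)" for v l x
      unfolding L_def letter_trans_def mem_Collect_eq prod.case M one
      using even_neq T3 letter_msg_less by (cases l) auto
    have "agree work_states T L"
      unfolding agree_def L using work by (auto simp del: mult_Suc_right) fastforce+
    from T(5)[OF this, of e] have d: "(\<exists>w m. acc L m p (w, enc_stack [e] @ w)) \<longleftrightarrow> (\<exists>z. eval d [e] z)" .
    have L0: "(0, l, x) \<in> L \<longleftrightarrow> l = (True, False) \<and> x = p" for l x
      unfolding L using TX by fastforce
    have chain: "(2 * Suc k, l, x) \<in> L \<longleftrightarrow> l = (True, True) \<and> x = 2 * k" if "k < e" for k l x
      unfolding L using that TX by fastforce
    have acc0: "acc L n 0 (a, b) \<longleftrightarrow> (\<exists>m a'. n = Suc m \<and> a = False # a' \<and> acc L m p (a', b))" for n a b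
      by (cases n) (auto simp: acc_Suc L0)
    have "accepts (2 * e) (?M e) \<longleftrightarrow> (\<exists>w. \<exists>n. acc L n (2 * e) (w, w))"
      by (simp add: accepts_def L_def)
    also have "\<dots> \<longleftrightarrow> (\<exists>w a n. w = replicate e True @ a \<and> acc L n 0 (a, w))"
      using acc_input_chain[OF chain order_refl] by simp
    \<comment> \<open>The chain and state 0 have moved the leading head past
      \<open>enc_stack [e]\<close>, which thereby becomes the content of the queue.\<close>
    also have "\<dots> \<longleftrightarrow> (\<exists>a m. acc L m p (a, enc_stack [e] @ a))"
      unfolding acc0 by (auto simp: enc_stack_def)
    finally show ?thesis
      using d by blast
  qed
  ultimately show thesis
    by (rule that)
qed

text \<open>The machine decoded from \<^term>\<open>e\<close> is run on \<^term>\<open>e\<close> itself.\<close>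

lemma not_decidable:
  assumes "\<And>i T. checker i T \<Longrightarrow> (1, (True, 9), 1) \<in> set T \<Longrightarrow> Q (ring_system (i, T)) \<longleftrightarrow> \<not> accepts i T"
  shows "\<not> decidable_on wf_system enc_system Q"
proof
  assume "decidable_on wf_system enc_system Q"
  then obtain D where "\<forall>S. wf_system S \<longrightarrow> eval D [enc_system S] (if Q S then 1 else 0)"
    unfolding decidable_on_def by blast
  \<comment> \<open>\<open>d\<close> can be fixed before the transitions \<open>P\<close> that are
    compiled from it, because \<open>machine_code\<close> depends on \<open>e\<close> only;
    \<open>P\<close> comes in when \<open>e\<close> is chosen as its code.\<close>
  with recursive_machine_code obtain d where
    d: "\<And>e S. wf_system S \<Longrightarrow> machine_code ([e] ! 0) = enc_system S \<Longrightarrow> (\<exists>z. eval d [e] z) \<longleftrightarrow> Q S"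
    by (rule recursive_halting_iff) blast
  obtain P where P: "\<And>e. checker (2 * e) ((2 * e, (False, 6), 3) # input_chain e @ P)"
    "(1, (True, 9), 1) \<in> set P"
    "\<And>e. accepts (2 * e) ((2 * e, (False, 6), 3) # input_chain e @ P) \<longleftrightarrow> (\<exists>z. eval d [e] z)"
    using machine_correct[of d] by blast
  define e where "e = list_encode (map enc_trans P)"
  have "wf_system (machine P e)"
    unfolding machine_def by (rule wf_ring_system[OF P(1)])
  then have "(\<exists>z. eval d [e] z) \<longleftrightarrow> Q (machine P e)"
    using enc_machine[OF e_def] by (intro d) simp_all
  also have "\<dots> \<longleftrightarrow> \<not> (\<exists>z. eval d [e] z)"
    unfolding machine_def P(3)[symmetric] by (rule assms[OF P(1)]) (use P(2) in simp)
  finally show False by blast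
qed

theorem theorem3p8:
  shows "\<not> decidable_on wf_system enc_system synchronizable
       \<and> \<not> decidable_on wf_system enc_system language_synchronizable"
  \<comment> \<open>One reduction serves both properties: nonacceptance yields the stronger one, and
    acceptance refutes the weaker one.\<close>
  using synchronizable_if_not_accepts not_language_synchronizable_if_accepts synchronizable_imp_language
  by (intro conjI not_decidable) blast+

end
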